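(* Let $n,p$ be positive integers with $p>n$, let $\kappa_n\in[1,\infty)$, and let $X_n\in\mathbb{R}^{p\times n}$ be of full column rank. Put $S_n=\frac1n X_nX_n^T\in\mathbb{R}^{p\times p}$, and let $S_n=U\hat\Lambda U^T$ be a spectral decomposition of $S_n$, with $U\in\mathbb{R}^{p\times p}$ orthogonal and $\hat\Lambda=\mathrm{Diag}(\hat\lambda_1,\dots,\hat\lambda_p)$, $\hat\lambda_1\ge\cdots\ge\hat\lambda_n>\hat\lambda_{n+1}=\cdots=\hat\lambda_p=0$. Then the solution $\hat\Sigma$ of the condition number constrained covariance matrix approximation problem $$\hat\Sigma=\mathop{\mathrm{argmin}}_{\Sigma\in\mathcal{P}_+^p}\|\Sigma-S_n\|_F\quad\text{subject to}\quad \kappa(\Sigma)\le\kappa_n$$ is given by $$\hat\Sigma=U\Lambda^*U^T,$$ where, for suitable (optimal) integers $\alpha^*\in\{1,\dots,n\}$ and $\beta^*\in\{2,\dots,n+1\}$ with $\alpha^*\le\beta^*-1$, $$\Lambda^*=\mathrm{Diag}(\underbrace{\kappa_n\mu^*,\dots,\kappa_n\mu^*}_{\alpha^*\text{ entries}},\hat\lambda_{\alpha^*+1},\dots,\hat\lambda_{\beta^*-1},\underbrace{\mu^*,\dots,\mu^*}_{p-\beta^*+1\text{ entries}}),$$ $$\mu^*=\frac{\kappa_n\sum_{i=1}^{\alpha^*}\hat\lambda_i+\sum_{i=\beta^*}^{n}\hat\lambda_i}{\alpha^*\kappa_n^2+p-\beta^*+1},$$ and such optimal $\alpha^*$ and $\beta^*$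 can be determined with $O(n)$ operations from $n$, $p$, $\kappa_n$ and the sorted list $\hat\lambda_1\ge\cdots\ge\hat\lambda_n$.
   Context: $\|\cdot\|_F$ is the Frobenius norm. $\mathcal{P}_+^p$ is the cone of real symmetric positive semidefinite $p\times p$ matrices. For $\Sigma\in\mathcal{P}_+^p$, $\lambda_1(\Sigma)$ and $\lambda_p(\Sigma)$ are its largest and smallest eigenvalues, and $\kappa(\Sigma)=\lambda_1(\Sigma)/\lambda_p(\Sigma)$ is its condition number; a matrix $\Sigma\in\mathcal{P}_+^p$ with $\lambda_p(\Sigma)=0$ (in particular $\Sigma=0$) does not satisfy the constraint $\kappa(\Sigma)\le\kappa_n$, so feasible matrices are positive definite. $\mathrm{Diag}(\cdot)$ is the diagonal matrix with the listed entries. Empty sums equal $0$ (e.g. $\sum_{i=\beta^*}^n$ when $\beta^*=n+1$), and the middle block $\hat\lambda_{\alpha^*+1},\dots,\hat\lambda_{\beta^*-1}$ is empty when $\beta^*=\alpha^*+1$. An operation is one arithmetic operation or comparison of real numbers; the $O(n)$ count concerns only the search for $\alpha^*,\beta^*$ once the eigenvalues are available, with an absolute implied constant. *)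

theory Defs
  imports
    "Jordan_Normal_Form.DL_Rank"
    "Jordan_Normal_Form.Spectral_Radius"
begin

section \<open>The condition number constrained approximation problem\<close>

definition frobenius_norm :: "real mat \<Rightarrow> real" where
  "frobenius_norm A = sqrt (\<Sum>i<dim_row A. \<Sum>j<dim_col A. (A $$ (i, j))\<^sup>2)"

definition psd_cone :: "nat \<Rightarrow> real mat set" where
  "psd_cone p = {A \<in> carrier_mat p p.
     A\<^sup>T = A \<and> (\<forall>v \<in> carrier_vec p. 0 \<le> v \<bullet> (A *\<^sub>v v))}"

text \<open>The next three notions are meant for symmetric matrices of positive dimension, whose
  real spectrum is finite and nonempty.\<close>

definition max_eigenvalue :: "real mat \<Rightarrow> real" where
  "max_eigenvalue A = Max (spectrum A)"

definition min_eigenvalue :: "real mat \<Rightarrow> real" where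
  "min_eigenvalue A = Min (spectrum A)"

definition condition_number :: "real mat \<Rightarrow> real" where
  "condition_number A = max_eigenvalue A / min_eigenvalue A"

text \<open>Singular matrices violate the constraint. This has to be said explicitly, because
  division by zero yields zero in HOL.\<close>

definition feasible :: "nat \<Rightarrow> real \<Rightarrow> real mat \<Rightarrow> bool" where
  "feasible p \<kappa> A \<longleftrightarrow>
     A \<in> psd_cone p \<and> min_eigenvalue A \<noteq> 0 \<and> condition_number A \<le> \<kappa>"

definition solutions :: "nat \<Rightarrow> real \<Rightarrow> real mat \<Rightarrow> real mat set" where
  "solutions p \<kappa> S = {A. is_arg_min (\<lambda>A. frobenius_norm (A - S)) (feasible p \<kappa>) A}"

definition sample_cov :: "nat \<Rightarrow> real mat \<Rightarrow> real mat" where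
  "sample_cov n X = (1 / real n) \<cdot>\<^sub>m (X * X\<^sup>T)"

text \<open>Sequences of eigenvalues are indexed from 1, whereas matrix indices start from 0. The
  library predicate \<open>orthogonal_mat\<close> only requires the columns to be nonzero and
  pairwise orthogonal, so orthogonality of \<open>U\<close> is spelled out.\<close>

definition Diag :: "nat \<Rightarrow> (nat \<Rightarrow> real) \<Rightarrow> real mat" where
  "Diag p d = mat_diag p (\<lambda>i. d (Suc i))"

definition spectral_decomposition :: "nat \<Rightarrow> real mat \<Rightarrow> real mat \<Rightarrow> (nat \<Rightarrow> real) \<Rightarrow> bool" where
  "spectral_decomposition p S U lam \<longleftrightarrow>
     U \<in> carrier_mat p p \<and> U\<^sup>T * U = 1\<^sub>m p \<and> U * U\<^sup>T = 1\<^sub>m p \<and>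
     S = U * Diag p lam * U\<^sup>T"

definition mu_star :: "nat \<Rightarrow> nat \<Rightarrow> real \<Rightarrow> (nat \<Rightarrow> real) \<Rightarrow> nat \<Rightarrow> nat \<Rightarrow> real" where
  "mu_star n p \<kappa> lam \<alpha> \<beta> =
     (\<kappa> * (\<Sum>i=1..\<alpha>. lam i) + (\<Sum>i=\<beta>..n. lam i)) /
     (real \<alpha> * \<kappa>\<^sup>2 + real p - real \<beta> + 1)"

definition Lambda_star :: "nat \<Rightarrow> nat \<Rightarrow> real \<Rightarrow> (nat \<Rightarrow> real) \<Rightarrow> nat \<Rightarrow> nat \<Rightarrow> real mat" where
  "Lambda_star n p \<kappa> lam \<alpha> \<beta> =
     (let \<mu> = mu_star n p \<kappa> lam \<alpha> \<beta> in
      Diag p (\<lambda>i. if i \<le> \<alpha> then \<kappa> * \<mu> else if i < \<beta> then lam i else \<mu>))"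

section \<open>Model of computation\<close>

text \<open>
  Programs of a real random access machine with finitely many accessible registers, each holding
  a real number, and a read-only input array of real numbers. A program is a fixed finite object
  and contains no constants except integers, so one program has to serve all input sizes.
  Integers such as loop counters and array positions are held in registers like all other
  numbers, and arithmetic on them is charged as well.
\<close>

datatype arith_op = Plus | Minus | Times | Divide

datatype comparison = Le | Less | Equal

datatype com =
    Skip
  | Put nat int
  | Move nat nat
  | Load nat nat
  | Arith nat arith_op nat nat
  | Seq com com
  | Cond nat comparison nat com com
  | While nat comparison nat com

type_synonym state = "nat \<Rightarrow> real"

fun apply_op :: "arith_op \<Rightarrow> real \<Rightarrow> real \<Rightarrow> real" where
  "apply_op Plus x y = x + y"
| "apply_op Minus x y = x - y"
| "apply_op Times x y = x * y"
| "apply_op Divide x y = x / y"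

fun compare :: "comparison \<Rightarrow> real \<Rightarrow> real \<Rightarrow> bool" where
  "compare Le x y \<longleftrightarrow> x \<le> y"
| "compare Less x y \<longleftrightarrow> x < y"
| "compare Equal x y \<longleftrightarrow> x = y"

text \<open>
  \<open>exec xs c s k t\<close>: with input array \<open>xs\<close>, program \<open>c\<close> started in
  state \<open>s\<close> terminates in state \<open>t\<close> after exactly \<open>k\<close> operations,
  i.e. arithmetic operations and comparisons. In \<open>Load r a\<close> register \<open>a\<close> holds the
  array position, counted from 1. Division by zero and access outside the array are errors: no
  derivation exists for them. Data movement is not charged; this hides no work, as each loop
  iteration costs at least one comparison, so the number of executed instructions is bounded
  by a constant (depending on the program only) times \<open>k + 1\<close>.
\<close>

inductive exec :: "real list \<Rightarrow> com \<Rightarrow> state \<Rightarrow> nat \<Rightarrow> state \<Rightarrow> bool" for xs :: "real list" where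
  Skip: "exec xs Skip s 0 s"
| Put: "exec xs (Put r c) s 0 (s(r := real_of_int c))"
| Move: "exec xs (Move r a) s 0 (s(r := s a))"
| Load: "s a = real i \<Longrightarrow> 1 \<le> i \<Longrightarrow> i \<le> length xs \<Longrightarrow>
    exec xs (Load r a) s 0 (s(r := xs ! (i - 1)))"
| Arith: "(f = Divide \<Longrightarrow> s b \<noteq> 0) \<Longrightarrow>
    exec xs (Arith r f a b) s 1 (s(r := apply_op f (s a) (s b)))"
| Seq: "exec xs c1 s k s' \<Longrightarrow> exec xs c2 s' l t \<Longrightarrow> exec xs (Seq c1 c2) s (k + l) t"
| CondTrue: "compare q (s a) (s b) \<Longrightarrow> exec xs c1 s k t \<Longrightarrow>
    exec xs (Cond a q b c1 c2) s (Suc k) t"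
| CondFalse: "\<not> compare q (s a) (s b) \<Longrightarrow> exec xs c2 s k t \<Longrightarrow>
    exec xs (Cond a q b c1 c2) s (Suc k) t"
| WhileFalse: "\<not> compare q (s a) (s b) \<Longrightarrow> exec xs (While a q b c) s 1 s"
| WhileTrue: "compare q (s a) (s b) \<Longrightarrow> exec xs c s k s' \<Longrightarrow>
    exec xs (While a q b c) s' l t \<Longrightarrow> exec xs (While a q b c) s (Suc (k + l)) t"

definition initial_state :: "nat \<Rightarrow> nat \<Rightarrow> real \<Rightarrow> state" where
  "initial_state n p \<kappa> = (\<lambda>_. 0)(0 := real n, 1 := real p, 2 := \<kappa>)"

text \<open>The input array is \<open>lam 1, ..., lam n\<close>; the pair of indices is returned in registers
  0 and 1.\<close>

definition computes_within ::
    "nat \<Rightarrow> com \<Rightarrow> nat \<Rightarrow> nat \<Rightarrow> real \<Rightarrow> (nat \<Rightarrow> real) \<Rightarrow> nat \<Rightarrow> nat \<Rightarrow> bool" where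
  "computes_within N P n p \<kappa> lam \<alpha> \<beta> \<longleftrightarrow>
     (\<exists>k t. exec (map lam [1..<Suc n]) P (initial_state n p \<kappa>) k t \<and>
        k \<le> N \<and> t 0 = real \<alpha> \<and> t 1 = real \<beta>)"

end

theory Submission
  imports Defs "HOL-Analysis.Function_Topology"
begin

text \<open>
  Two observations turn the matrix problem into a problem about \<open>p\<close> real numbers.
  
  First, a symmetric matrix is feasible iff for some \<open>m > 0\<close> its quadratic form lies between
  \<open>m |v|\<^sup>2\<close> and \<open>\<kappa> m |v|\<^sup>2\<close> (\<open>feasible_iff_form_bounds\<close>).
  Behind this is the attainment of both extremes of the Rayleigh quotient at eigenvectors,
  by compactness of the sphere. In particular all diagonal entries
  of a feasible matrix lie in \<open>[m, \<kappa> m]\<close>, in every orthonormal basis.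
  
  Second, in the eigenbasis of \<open>S\<close> the target is diagonal. If \<open>D\<close> is
  the diagonal matrix with the numbers \<open>d i\<close> and \<open>B\<close> is any competitor, expanding the square gives
  \<open>|B - S|\<^sup>2 = |D - S|\<^sup>2 + |B - D|\<^sup>2 + 2 \<Sum>i. (d i - lam i) (B i i - d i)\<close>, where
  only diagonal entries of \<open>B\<close> meet the cross term. So if the last sum is nonnegative whenever the
  numbers \<open>B i i\<close> lie in an interval \<open>[m, \<kappa> m]\<close>, then \<open>D\<close> is optimal and is the
  only optimal matrix (\<open>solutions_diag\<close>).
  
  Let \<open>d\<close> arise from \<open>lam\<close> by clipping to \<open>[\<mu>, \<kappa> \<mu>]\<close>, with the first
  \<open>\<alpha>\<close> values cut down to \<open>\<kappa> \<mu>\<close> and those from position \<open>\<beta>\<close> on raised to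
  \<open>\<mu>\<close>. The residual \<open>d i - lam i\<close> is nonpositive on the first block, zero on the middle
  one and nonnegative on the last one, so over all numbers in \<open>[m, \<kappa> m]\<close> the sum of
  \<open>(d i - lam i) * x i\<close> is smallest for \<open>x\<close> equal to \<open>\<kappa> m\<close> on the first block
  and \<open>m\<close> on the last, where it is \<open>m\<close> times
  \<open>G = \<kappa> \<Sum>i\<le>\<alpha>. (\<kappa> \<mu> - lam i) + \<Sum>i\<ge>\<beta>. (\<mu> - lam i)\<close>. The value of
  \<open>\<mu>\<close> in the theorem is the root of \<open>G\<close>, the stationary point of the distance along the ray of
  multiples of the clipped matrix (\<open>clip_variational\<close>).
  Hence any pair of indices that is consistent with its own \<open>\<mu>\<close> is optimal
  (\<open>solutions_clip_pair\<close>).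
  
  A consistent pair is found by letting a level grow from \<open>0\<close> through the breakpoints
  \<open>lam i / \<kappa>\<close> and \<open>lam i\<close>. Each breakpoint passed lowers \<open>\<alpha>\<close> or
  \<open>\<beta>\<close> by one, and the scan stops as soon as the root of \<open>G\<close> for the current pair
  does not exceed the next breakpoint. Starting from \<open>(n, n + 1)\<close>, this
  takes fewer than \<open>2 n\<close> rounds; the two sums in \<open>\<mu>\<close> are updated incrementally, so that
  each round has constant cost (\<open>search_program_correct\<close>).
\<close>

section \<open>Quadratic forms and extreme eigenvalues of symmetric matrices\<close>

lemma transpose_scalar_prod:
  fixes A :: "real mat"
  assumes "A \<in> carrier_mat n m" "v \<in> carrier_vec m" "w \<in> carrier_vec n"
  shows "w \<bullet> (A *\<^sub>v v) = (A\<^sup>T *\<^sub>v w) \<bullet> v"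
  using transpose_vec_mult_scalar[of A n m v w] assms
  by (simp add: comm_scalar_prod[of _ n] comm_scalar_prod[of _ m])

lemma scalar_prod_self_nonneg: "0 \<le> v \<bullet> (v :: real vec)"
  by (simp add: scalar_prod_def sum_nonneg)

lemma scalar_prod_self_eq_0:
  fixes v :: "real vec"
  assumes "v \<in> carrier_vec p"
  shows "v \<bullet> v = 0 \<longleftrightarrow> v = 0\<^sub>v p"
  using conjugate_square_eq_0_vec[OF assms] by simp

lemma scalar_prod_self_pos:
  fixes v :: "real vec"
  assumes "v \<in> carrier_vec p" "v \<noteq> 0\<^sub>v p"
  shows "0 < v \<bullet> v"
  using assms scalar_prod_self_nonneg[of v] scalar_prod_self_eq_0[of v p] by simp

text \<open>
  A zero of a nonnegative quadratic form is a minimum, so the derivative vanishes there: along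
  \<open>v + t M v\<close> the linear coefficient is \<open>2 |M v|\<^sup>2\<close>.
\<close>

lemma psd_null_vector:
  fixes M :: "real mat"
  assumes M: "M \<in> carrier_mat p p" and sym: "M\<^sup>T = M"
    and psd: "\<And>w. w \<in> carrier_vec p \<Longrightarrow> 0 \<le> w \<bullet> (M *\<^sub>v w)"
    and v: "v \<in> carrier_vec p" and null: "v \<bullet> (M *\<^sub>v v) = 0"
  shows "M *\<^sub>v v = 0\<^sub>v p"
proof -
  define u where "u = M *\<^sub>v v"
  have u: "u \<in> carrier_vec p" using M v by (simp add: u_def)
  define a c where "a = u \<bullet> u" and "c = u \<bullet> (M *\<^sub>v u)"
  have vMu: "v \<bullet> (M *\<^sub>v u) = a"
    using transpose_scalar_prod[OF M u v] by (simp add: sym a_def u_def)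
  have expand: "0 \<le> 2 * t * a + t * t * c" for t
  proof -
    have Mu: "M *\<^sub>v u \<in> carrier_vec p" using M u by simp
    have "M *\<^sub>v (v + t \<cdot>\<^sub>v u) = u + t \<cdot>\<^sub>v (M *\<^sub>v u)"
      using M u v by (simp add: mult_add_distrib_mat_vec mult_mat_vec u_def)
    then have "(v + t \<cdot>\<^sub>v u) \<bullet> (M *\<^sub>v (v + t \<cdot>\<^sub>v u)) = v \<bullet> u + t * a + t * (a + t * c)"
      using u v Mu
      by (simp add: scalar_prod_add_distrib[where n = p] add_scalar_prod_distrib[where n = p]
          vMu a_def[symmetric] c_def[symmetric] algebra_simps)
    moreover have "v \<bullet> u = 0" using null by (simp add: u_def)
    ultimately show ?thesis using psd[of "v + t \<cdot>\<^sub>v u"] u v by (simp add: algebra_simps)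
  qed
  have "0 \<le> c" using psd[OF u] by (simp add: c_def)
  have "a = 0"
  proof (rule ccontr)
    assume "a \<noteq> 0"
    \<comment> \<open>the form is negative at t = - s; the 1 keeps the denominator positive when c = 0\<close>
    define s where "s = a / (c + 1)"
    have a: "a = s * (c + 1)" using \<open>0 \<le> c\<close> by (simp add: s_def)
    then have "0 < s\<^sup>2 * (c + 2)"
      using \<open>a \<noteq> 0\<close> \<open>0 \<le> c\<close> by (intro mult_pos_pos) auto
    moreover have "0 \<le> - (s\<^sup>2 * (c + 2))"
      using expand[of "- s"] unfolding a by (simp add: algebra_simps power2_eq_square)
    ultimately show False by linarith
  qed
  then show ?thesis
    using scalar_prod_self_eq_0[OF u] by (simp add: a_def u_def)
qed

text \<open>
  Points of \<open>p\<close>-dimensional space, with \<open>p\<close> a variable, are represented as functions on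
  all naturals that vanish from \<open>p\<close> on. Compactness in the product topology is Tychonoff's
  theorem.
\<close>

lemma compact_cube: "compact (PiE UNIV (\<lambda>i::nat. if i < p then {-1..1::real} else {0}))"
proof -
  have "compactin (product_topology (\<lambda>_. euclidean) UNIV)
      (PiE UNIV (\<lambda>i::nat. if i < p then {-1..1::real} else {0}))"
    unfolding compactin_PiE by auto
  then show ?thesis by (simp add: euclidean_product_topology)
qed

text \<open>
  The Rayleigh quotient attains its minimum \<open>l\<close> on the compact unit sphere. By minimality
  \<open>A - l I\<close> is positive semidefinite, and its form vanishes at the minimiser, which is therefore an
  eigenvector.
\<close>

lemma rayleigh_min:
  fixes A :: "real mat"
  assumes A: "A \<in> carrier_mat p p" and sym: "A\<^sup>T = A" and p: "0 < p"
  obtains l where "l \<in> spectrum A" "\<And>w. w \<in> carrier_vec p \<Longrightarrow> l * (w \<bullet> w) \<le> w \<bullet> (A *\<^sub>v w)"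
proof -
  define q where "q x = (\<Sum>i<p. x i * (\<Sum>j<p. A $$ (i, j) * x j))" for x :: "nat \<Rightarrow> real"
  define K where "K = PiE UNIV (\<lambda>i::nat. if i < p then {-1..1::real} else {0}) \<inter>
    {x. (\<Sum>i<p. x i * x i) = 1}"
  have q: "w \<bullet> (A *\<^sub>v w) = q (\<lambda>i. w $ i)" if "w \<in> carrier_vec p" for w
    using A that by (auto simp: q_def scalar_prod_def lessThan_atLeast0 intro!: sum.cong)
  have nrm: "w \<bullet> w = (\<Sum>i<p. w $ i * w $ i)" if "w \<in> carrier_vec p" for w
    using that by (simp add: scalar_prod_def lessThan_atLeast0)
  have coord: "continuous_on S (\<lambda>x :: nat \<Rightarrow> real. x i)" for S i
    by (rule continuous_on_subset[OF continuous_on_product_coordinates]) auto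
  have "closed {x :: nat \<Rightarrow> real. (\<Sum>i<p. x i * x i) = 1}"
    by (intro closed_Collect_eq continuous_intros coord)
  then have "compact K" unfolding K_def by (rule compact_Int_closed[OF compact_cube])
  moreover have "(\<lambda>i. if i = 0 then 1 else 0) \<in> K"
    using p by (auto simp: K_def if_distrib[of "\<lambda>y. y * _"] cong: if_cong)
  moreover have "continuous_on K q"
    unfolding q_def by (intro continuous_intros coord)
  ultimately obtain x where x: "x \<in> K" and least: "\<And>y. y \<in> K \<Longrightarrow> q x \<le> q y"
    using continuous_attains_inf[of K q] by blast
  define v where "v = vec p x"
  have v: "v \<in> carrier_vec p" by (simp add: v_def)
  have v1: "v \<bullet> v = 1" using x by (simp add: K_def nrm v v_def)
  have vA: "v \<bullet> (A *\<^sub>v v) = q x" by (simp add: q v) (simp add: q_def v_def)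
  have ray: "q x * (w \<bullet> w) \<le> w \<bullet> (A *\<^sub>v w)" if w: "w \<in> carrier_vec p" for w
  proof (cases "w = 0\<^sub>v p")
    case True
    then show ?thesis using A by simp
  next
    case False
    define r where "r = sqrt (w \<bullet> w)"
    have r: "0 < r" "r * r = w \<bullet> w"
      using scalar_prod_self_pos[OF w False] by (auto simp: r_def)
    define y where "y i = (if i < p then w $ i / r else 0)" for i
    have sq: "(\<Sum>i<p. y i * y i) = 1"
    proof -
      have "(\<Sum>i<p. y i * y i) = (\<Sum>i<p. w $ i * w $ i) / (r * r)"
        unfolding sum_divide_distrib by (rule sum.cong) (auto simp: y_def)
      also have "\<dots> = 1" using r(1) unfolding nrm[OF w, symmetric] r(2)[symmetric] by simp
      finally show ?thesis .
    qed
    have "y i \<in> {- 1..1}" if "i < p" for i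
    proof -
      have "y i * y i \<le> (\<Sum>i<p. y i * y i)"
        using that by (intro member_le_sum) auto
      then show ?thesis using sq abs_le_square_iff[of "y i" 1] by (simp add: power2_eq_square abs_le_iff)
    qed
    moreover have "y i = 0" if "\<not> i < p" for i using that by (simp add: y_def)
    ultimately have "y \<in> K" using sq by (auto simp: K_def PiE_iff)
    have "q y = q (\<lambda>i. w $ i) / (r * r)"
      unfolding q_def y_def by (simp add: sum_divide_distrib sum_distrib_left)
    moreover have "0 < w \<bullet> w" using scalar_prod_self_pos[OF w False] .
    ultimately show ?thesis
      using least[OF \<open>y \<in> K\<close>] by (simp add: r(2) q[OF w] pos_le_divide_eq)
  qed
  \<comment> \<open>the minimiser is a null vector of the shifted matrix\<close>
  define M where "M = A - q x \<cdot>\<^sub>m 1\<^sub>m p"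
  have M: "M \<in> carrier_mat p p" using A by (simp add: M_def minus_carrier_mat)
  have Mw: "M *\<^sub>v w = A *\<^sub>v w - q x \<cdot>\<^sub>v w" if "w \<in> carrier_vec p" for w
  proof -
    have "(q x \<cdot>\<^sub>m 1\<^sub>m p) *\<^sub>v w = q x \<cdot>\<^sub>v w"
      using that by (intro eq_vecI) (auto simp: row_smult)
    then show ?thesis using A that by (simp add: M_def minus_mult_distrib_mat_vec)
  qed
  have wMw: "w \<bullet> (M *\<^sub>v w) = w \<bullet> (A *\<^sub>v w) - q x * (w \<bullet> w)" if "w \<in> carrier_vec p" for w
    using that A by (simp add: Mw scalar_prod_minus_distrib[where n = p])
  have "M *\<^sub>v v = 0\<^sub>v p"
  proof (rule psd_null_vector[OF M])
    have "A $$ (j, i) = A $$ (i, j)" if "i < p" "j < p" for i j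
      using sym A that by (metis carrier_matD index_transpose_mat(1))
    then show "M\<^sup>T = M" using A by (intro eq_matI) (auto simp: M_def)
  qed (use v v1 vA ray in \<open>auto simp: wMw\<close>)
  then have "A *\<^sub>v v - q x \<cdot>\<^sub>v v = 0\<^sub>v p" using Mw[OF v] by simp
  then have "A *\<^sub>v v = q x \<cdot>\<^sub>v v"
    using A v by (auto simp: vec_eq_iff)
  moreover have "v \<noteq> 0\<^sub>v p" using v1 v by auto
  ultimately have "q x \<in> spectrum A"
    using A v by (auto simp: spectrum_def eigenvalue_def eigenvector_def)
  then show ?thesis using ray that by blast
qed

lemma rayleigh_max:
  fixes A :: "real mat"
  assumes A: "A \<in> carrier_mat p p" and sym: "A\<^sup>T = A" and p: "0 < p"
  obtains l where "l \<in> spectrum A" "\<And>w. w \<in> carrier_vec p \<Longrightarrow> w \<bullet> (A *\<^sub>v w) \<le> l * (w \<bullet> w)"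
proof -
  have neg: "(- A) *\<^sub>v w = - (A *\<^sub>v w)" if "w \<in> carrier_vec p" for w
    using A that by (intro eq_vecI) auto
  have "- A \<in> carrier_mat p p" "(- A)\<^sup>T = - A" using A sym by (auto simp: transpose_uminus)
  then obtain l where l: "l \<in> spectrum (- A)"
    "\<And>w. w \<in> carrier_vec p \<Longrightarrow> l * (w \<bullet> w) \<le> w \<bullet> ((- A) *\<^sub>v w)"
    using rayleigh_min p by metis
  from l(1) obtain v where v: "v \<in> carrier_vec p" "v \<noteq> 0\<^sub>v p" "- (A *\<^sub>v v) = l \<cdot>\<^sub>v v"
    using A neg by (auto simp: spectrum_def eigenvalue_def eigenvector_def)
  have "A *\<^sub>v v = (- l) \<cdot>\<^sub>v v" using v A by (auto simp: vec_eq_iff)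
  then have "- l \<in> spectrum A"
    using v A by (auto simp: spectrum_def eigenvalue_def eigenvector_def)
  moreover have "w \<bullet> (A *\<^sub>v w) \<le> (- l) * (w \<bullet> w)" if "w \<in> carrier_vec p" for w
    using l(2)[OF that] A that by (simp add: neg)
  ultimately show ?thesis using that by blast
qed

definition form_bounds :: "nat \<Rightarrow> real \<Rightarrow> real \<Rightarrow> real mat \<Rightarrow> bool" where
  "form_bounds p a b A \<longleftrightarrow>
     (\<forall>v\<in>carrier_vec p. a * (v \<bullet> v) \<le> v \<bullet> (A *\<^sub>v v) \<and> v \<bullet> (A *\<^sub>v v) \<le> b * (v \<bullet> v))"

lemma spectrum_form_bounds:
  assumes "A \<in> carrier_mat p p" "form_bounds p a b A"
  shows "spectrum A \<subseteq> {a..b}"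
proof
  fix l assume "l \<in> spectrum A"
  then obtain v where v: "v \<in> carrier_vec p" "v \<noteq> 0\<^sub>v p" "A *\<^sub>v v = l \<cdot>\<^sub>v v"
    using assms by (auto simp: spectrum_def eigenvalue_def eigenvector_def)
  then have "a * (v \<bullet> v) \<le> l * (v \<bullet> v)" "l * (v \<bullet> v) \<le> b * (v \<bullet> v)"
    using assms(2) by (auto simp: form_bounds_def)
  then show "l \<in> {a..b}" using scalar_prod_self_pos[OF v(1,2)] by simp
qed

text \<open>
  Left to right, \<open>m\<close> is the smallest eigenvalue, and the extreme values of the form are eigenvalues.
  Right to left, all eigenvalues lie in \<open>[m, \<kappa> m]\<close>. The bounds by quadratic forms are what is
  needed later, as they pass to diagonal entries in any orthonormal basis.
\<close>

lemma feasible_iff_form_bounds: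
  assumes p: "0 < p" and \<kappa>: "0 \<le> \<kappa>"
  shows "feasible p \<kappa> A \<longleftrightarrow>
    A \<in> carrier_mat p p \<and> A\<^sup>T = A \<and> (\<exists>m>0. form_bounds p m (\<kappa> * m) A)"
    (is "_ \<longleftrightarrow> ?R")
proof
  assume f: "feasible p \<kappa> A"
  then have A: "A \<in> carrier_mat p p" "A\<^sup>T = A"
    and psd: "\<And>v. v \<in> carrier_vec p \<Longrightarrow> 0 \<le> v \<bullet> (A *\<^sub>v v)"
    by (auto simp: feasible_def psd_cone_def)
  note fin = card_finite_spectrum(1)[OF A(1)]
  obtain l where l: "l \<in> spectrum A" "\<And>w. w \<in> carrier_vec p \<Longrightarrow> l * (w \<bullet> w) \<le> w \<bullet> (A *\<^sub>v w)"
    using rayleigh_min[OF A p] by metis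
  obtain h where h: "h \<in> spectrum A" "\<And>w. w \<in> carrier_vec p \<Longrightarrow> w \<bullet> (A *\<^sub>v w) \<le> h * (w \<bullet> w)"
    using rayleigh_max[OF A p] by metis
  define m where "m = min_eigenvalue A"
  have "m \<in> spectrum A" using l(1) fin unfolding m_def min_eigenvalue_def by (intro Min_in) auto
  then obtain v where v: "v \<in> carrier_vec p" "v \<noteq> 0\<^sub>v p" "A *\<^sub>v v = m \<cdot>\<^sub>v v"
    using A by (auto simp: spectrum_def eigenvalue_def eigenvector_def)
  have "0 \<le> m" using psd[OF v(1)] v scalar_prod_self_pos[OF v(1,2)] by (simp add: zero_le_mult_iff)
  moreover have "m \<noteq> 0" using f by (simp add: feasible_def m_def)
  ultimately have m: "0 < m" by simp
  have "m \<le> l" using l(1) fin by (simp add: m_def min_eigenvalue_def)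
  moreover have "h \<le> max_eigenvalue A" using h(1) fin by (simp add: max_eigenvalue_def)
  moreover have "max_eigenvalue A \<le> \<kappa> * m"
    using f m by (simp add: feasible_def condition_number_def m_def[symmetric] divide_le_eq)
  ultimately have "form_bounds p m (\<kappa> * m) A"
    unfolding form_bounds_def using l(2) h(2) scalar_prod_self_nonneg by (meson mult_right_mono order_trans)
  then show ?R using A m by blast
next
  assume ?R
  then obtain m where A: "A \<in> carrier_mat p p" "A\<^sup>T = A" and m: "0 < m"
    and b: "form_bounds p m (\<kappa> * m) A" by blast
  note fin = card_finite_spectrum(1)[OF A(1)]
  have ne: "spectrum A \<noteq> {}" using rayleigh_min[OF A p] by (metis empty_iff)
  have sp: "spectrum A \<subseteq> {m..\<kappa> * m}" using spectrum_form_bounds[OF A(1) b] .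
  have lo: "m \<le> min_eigenvalue A"
    using sp fin ne by (auto simp: min_eigenvalue_def)
  have "max_eigenvalue A \<le> \<kappa> * m"
    using sp fin ne by (auto simp: max_eigenvalue_def)
  also have "\<dots> \<le> \<kappa> * min_eigenvalue A" using lo \<kappa> by (intro mult_left_mono)
  finally have "condition_number A \<le> \<kappa>"
    using lo m by (simp add: condition_number_def divide_le_eq)
  moreover have "0 \<le> v \<bullet> (A *\<^sub>v v)" if "v \<in> carrier_vec p" for v
  proof -
    have "0 \<le> m * (v \<bullet> v)" using m scalar_prod_self_nonneg by simp
    then show ?thesis using b that unfolding form_bounds_def by (meson order_trans)
  qed
  ultimately show "feasible p \<kappa> A" using A lo m by (auto simp: feasible_def psd_cone_def)
qed

section \<open>Rotation to the diagonal case\<close>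

definition frob_sq :: "real mat \<Rightarrow> real" where
  "frob_sq A = (\<Sum>i<dim_row A. \<Sum>j<dim_col A. (A $$ (i, j))\<^sup>2)"

lemma frobenius_norm_sqrt: "frobenius_norm A = sqrt (frob_sq A)"
  by (simp add: frobenius_norm_def frob_sq_def)

lemma frob_sq_transpose: "frob_sq A\<^sup>T = frob_sq A"
  by (simp add: frob_sq_def) (rule sum.swap)

lemma frob_sq_gram: "frob_sq A = (\<Sum>j<dim_col A. (A\<^sup>T * A) $$ (j, j))"
proof -
  have "frob_sq A = (\<Sum>j<dim_col A. \<Sum>i<dim_row A. (A $$ (i, j))\<^sup>2)"
    unfolding frob_sq_def by (rule sum.swap)
  then show ?thesis
    by (simp add: scalar_prod_def power2_eq_square lessThan_atLeast0)
qed

text \<open>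
  The squared Frobenius norm is the trace of the Gram matrix, which an isometry leaves unchanged.
\<close>

lemma frob_sq_mult_isometry:
  assumes "U \<in> carrier_mat p p" "U\<^sup>T * U = 1\<^sub>m p" "M \<in> carrier_mat p q"
  shows "frob_sq (U * M) = frob_sq M"
proof -
  have "(U * M)\<^sup>T * (U * M) = M\<^sup>T * (U\<^sup>T * U * M)"
    using assms(1,3)
    by (simp add: transpose_mult[of _ p p _ q] assoc_mult_mat[of _ q p _ p _ q]
        assoc_mult_mat[of _ p p _ p _ q])
  also have "\<dots> = M\<^sup>T * M" using assms by simp
  finally show ?thesis using assms by (simp add: frob_sq_gram)
qed

lemma frob_sq_rotate:
  assumes U: "U \<in> carrier_mat p p" "U\<^sup>T * U = 1\<^sub>m p" and M: "M \<in> carrier_mat p p"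
  shows "frob_sq (U * M * U\<^sup>T) = frob_sq M"
proof -
  have "frob_sq (U * M * U\<^sup>T) = frob_sq (U * (M * U\<^sup>T))"
    using U M by (simp add: assoc_mult_mat[of _ p p _ p _ p])
  also have "\<dots> = frob_sq (M * U\<^sup>T)" using U M by (intro frob_sq_mult_isometry) auto
  also have "\<dots> = frob_sq (U * M\<^sup>T)"
    using U M frob_sq_transpose[of "M * U\<^sup>T"] by (simp add: transpose_mult[where ?n = p])
  also have "\<dots> = frob_sq M" using U M by (simp add: frob_sq_mult_isometry frob_sq_transpose)
  finally show ?thesis .
qed

lemma frob_sq_eq_0:
  assumes "frob_sq (A - B) = 0" "A \<in> carrier_mat p q" "B \<in> carrier_mat p q"
  shows "A = B"
proof (rule eq_matI)
  fix i j assume "i < dim_row B" "j < dim_col B"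
  then show "A $$ (i, j) = B $$ (i, j)"
    using assms by (auto simp: frob_sq_def sum_nonneg_eq_0_iff sum_nonneg)
qed (use assms in auto)

lemma frob_sq_nonneg: "0 \<le> frob_sq A"
  by (simp add: frob_sq_def sum_nonneg)

text \<open>
  Polarization around \<open>Diag p d\<close>. Off the diagonal both \<open>Diag p d\<close> and \<open>Diag p l\<close>
  vanish, so only diagonal entries contribute to the cross term. The index \<open>i - 1\<close> translates
  from sequences counted from 1 to matrix indices counted from 0.
\<close>

lemma frob_sq_diag_expansion:
  assumes B: "B \<in> carrier_mat p p"
  shows "frob_sq (B - Diag p l) = frob_sq (Diag p d - Diag p l) + frob_sq (B - Diag p d) +
    2 * (\<Sum>i=1..p. (d i - l i) * (B $$ (i - 1, i - 1) - d i))"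
proof -
  have "(\<Sum>i=1..p. (d i - l i) * (B $$ (i - 1, i - 1) - d i))
      = (\<Sum>i<p. (d (Suc i) - l (Suc i)) * (B $$ (i, i) - d (Suc i)))"
    by (rule sum.reindex_bij_witness[of _ Suc "\<lambda>i. i - 1"]) auto
  also have "\<dots> = (\<Sum>i<p. \<Sum>j<p. if i = j then (d (Suc i) - l (Suc i)) * (B $$ (i, i) - d (Suc i)) else 0)"
    by simp
  finally have *: "2 * (\<Sum>i=1..p. (d i - l i) * (B $$ (i - 1, i - 1) - d i)) =
    (\<Sum>i<p. \<Sum>j<p. 2 * (if i = j then (d (Suc i) - l (Suc i)) * (B $$ (i, i) - d (Suc i)) else 0))"
    by (simp only: sum_distrib_left)
  have D [simp]: "Diag p e \<in> carrier_mat p p" for e by (simp add: Diag_def)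
  have F: "frob_sq M = (\<Sum>i<p. \<Sum>j<p. (M $$ (i, j))\<^sup>2)" if "M \<in> carrier_mat p p" for M
    using that by (simp add: frob_sq_def)
  have entry: "((B - Diag p l) $$ (i, j))\<^sup>2 =
      ((Diag p d - Diag p l) $$ (i, j))\<^sup>2 + ((B - Diag p d) $$ (i, j))\<^sup>2 +
      2 * (if i = j then (d (Suc i) - l (Suc i)) * (B $$ (i, i) - d (Suc i)) else 0)"
    if "i < p" "j < p" for i j
    using that B by (simp add: Diag_def mat_diag_def power2_eq_square algebra_simps)
  have "frob_sq (B - Diag p l) = (\<Sum>i<p. \<Sum>j<p.
      ((Diag p d - Diag p l) $$ (i, j))\<^sup>2 + ((B - Diag p d) $$ (i, j))\<^sup>2 +
      2 * (if i = j then (d (Suc i) - l (Suc i)) * (B $$ (i, i) - d (Suc i)) else 0))"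
    unfolding F[OF minus_carrier_mat[OF D]] by (intro sum.cong refl entry) auto
  then show ?thesis
    unfolding * F[OF minus_carrier_mat[OF D]] by (simp only: sum.distrib)
qed

lemma rotate_transpose:
  assumes "U \<in> carrier_mat p p" "M \<in> carrier_mat p p"
  shows "(U * M * U\<^sup>T)\<^sup>T = U * M\<^sup>T * (U\<^sup>T :: real mat)"
  using assms by (simp add: transpose_mult[of _ p p _ p] assoc_mult_mat[of _ p p _ p _ p])

lemma rotated_diag_entry:
  assumes U: "U \<in> carrier_mat p p" and A: "A \<in> carrier_mat p p" and i: "i < p"
  shows "(U\<^sup>T * A * U) $$ (i, i) = col U i \<bullet> (A *\<^sub>v col U i)"
proof -
  have "U\<^sup>T * A * U = U\<^sup>T * (A * U)"
    using U A by (simp add: assoc_mult_mat[of _ p p _ p _ p])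
  then show ?thesis using U A i by (simp add: col_mult2[of _ p p _ p] mult_mat_vec_def)
qed

lemma form_bounds_rotated_diag:
  assumes U: "U \<in> carrier_mat p p" "U\<^sup>T * U = 1\<^sub>m p" and A: "A \<in> carrier_mat p p"
    and b: "form_bounds p a b A" and i: "i < p"
  shows "(U\<^sup>T * A * U) $$ (i, i) \<in> {a..b}"
proof -
  have "(U\<^sup>T * U) $$ (i, i) = 1" using U(2) i by simp
  then have "col U i \<bullet> col U i = 1" using U(1) i by simp
  moreover have "col U i \<in> carrier_vec p" using U(1) i by auto
  ultimately show ?thesis
    using b by (force simp: rotated_diag_entry[OF U(1) A i] form_bounds_def)
qed

lemma form_bounds_diag:
  assumes U: "U \<in> carrier_mat p p" "U * U\<^sup>T = 1\<^sub>m p"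
    and d: "\<And>i. i \<in> {1..p} \<Longrightarrow> d i \<in> {a..b}"
  shows "form_bounds p a b (U * Diag p d * U\<^sup>T)"
  unfolding form_bounds_def
proof (rule ballI)
  fix v :: "real vec" assume v: "v \<in> carrier_vec p"
  define w where "w = U\<^sup>T *\<^sub>v v"
  have w: "w \<in> carrier_vec p" using U v by (simp add: w_def)
  have D: "Diag p d \<in> carrier_mat p p" by (simp add: Diag_def)
  have "w \<bullet> w = (U\<^sup>T *\<^sub>v v) \<bullet> w" by (simp add: w_def)
  also have "\<dots> = v \<bullet> (U *\<^sub>v w)" using transpose_scalar_prod[OF U(1) w v] by simp
  also have "U *\<^sub>v w = (U * U\<^sup>T) *\<^sub>v v"
    unfolding w_def using U(1) v by (intro assoc_mult_mat_vec[symmetric]) auto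
  finally have ww: "w \<bullet> w = v \<bullet> v" using U v by simp
  have "(U * Diag p d * U\<^sup>T) *\<^sub>v v = U *\<^sub>v (Diag p d *\<^sub>v w)"
    using U(1) D v by (simp add: w_def assoc_mult_mat_vec[where ?n\<^sub>1 = p and ?n\<^sub>2 = p and ?n\<^sub>3 = p])
  then have "v \<bullet> ((U * Diag p d * U\<^sup>T) *\<^sub>v v) = w \<bullet> (Diag p d *\<^sub>v w)"
    using transpose_scalar_prod[OF U(1) _ v, of "Diag p d *\<^sub>v w"] D w by (simp add: w_def)
  also have "\<dots> = (\<Sum>i<p. d (Suc i) * (w $ i * w $ i))"
    using w by (simp add: scalar_prod_def Diag_def mat_diag_def lessThan_atLeast0 mult_mat_vec_def
        if_distrib[of "\<lambda>x. x * _"] cong: if_cong) (simp add: algebra_simps)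
  finally have form: "v \<bullet> ((U * Diag p d * U\<^sup>T) *\<^sub>v v) = (\<Sum>i<p. d (Suc i) * (w $ i * w $ i))" .
  have sq: "v \<bullet> v = (\<Sum>i<p. w $ i * w $ i)"
    using w unfolding ww[symmetric] by (simp add: scalar_prod_def lessThan_atLeast0)
  show "a * (v \<bullet> v) \<le> v \<bullet> ((U * Diag p d * U\<^sup>T) *\<^sub>v v) \<and>
      v \<bullet> ((U * Diag p d * U\<^sup>T) *\<^sub>v v) \<le> b * (v \<bullet> v)"
    unfolding form unfolding sq sum_distrib_left using d
    by (intro conjI sum_mono mult_right_mono) auto
qed

lemma rotate_inverse:
  assumes U: "U \<in> carrier_mat p p" "U * U\<^sup>T = 1\<^sub>m p" and A: "A \<in> carrier_mat p p"
  shows "U * (U\<^sup>T * A * U) * U\<^sup>T = (A :: real mat)"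
proof -
  have "U * (U\<^sup>T * A * U) * U\<^sup>T = (U * U\<^sup>T) * A * (U * U\<^sup>T)"
    using U(1) A by (simp add: assoc_mult_mat[of _ p p _ p _ p])
  then show ?thesis using U A by simp
qed

lemma rotate_minus:
  assumes "U \<in> carrier_mat p p" "A \<in> carrier_mat p p" "B \<in> carrier_mat p p"
  shows "U * A * U\<^sup>T - U * B * U\<^sup>T = U * (A - B) * (U\<^sup>T :: real mat)"
  using assms by (simp add: mult_minus_distrib_mat[where ?nr = p and ?n = p and ?nc = p]
      minus_mult_distrib_mat[where ?nr = p and ?n = p and ?nc = p])

text \<open>
  By the expansion in the basis given by \<open>U\<close>, the variational inequality makes
  \<open>|A - S|\<^sup>2\<close> exceed \<open>|C - S|\<^sup>2\<close> by at least \<open>|A - C|\<^sup>2\<close> for every feasible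
  \<open>A\<close>, where \<open>C\<close> is the matrix claimed to be optimal. This yields optimality and
  uniqueness at once.
\<close>

lemma solutions_diag:
  assumes U: "U \<in> carrier_mat p p" "U\<^sup>T * U = 1\<^sub>m p" "U * U\<^sup>T = 1\<^sub>m p"
    and S: "S = U * Diag p l * U\<^sup>T" and p: "0 < p" and \<kappa>: "0 \<le> \<kappa>"
    and \<mu>: "0 < \<mu>" and d: "\<And>i. i \<in> {1..p} \<Longrightarrow> d i \<in> {\<mu>..\<kappa> * \<mu>}"
    and variational: "\<And>m x. \<lbrakk>0 < m; \<And>i. i \<in> {1..p} \<Longrightarrow> x i \<in> {m..\<kappa> * m}\<rbrakk>
      \<Longrightarrow> 0 \<le> (\<Sum>i=1..p. (d i - l i) * (x i - d i))"
  shows "solutions p \<kappa> S = {U * Diag p d * U\<^sup>T}"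
proof -
  let ?C = "U * Diag p d * U\<^sup>T"
  have D [simp]: "Diag p e \<in> carrier_mat p p" for e by (simp add: Diag_def)
  have "(Diag p d)\<^sup>T = Diag p d" by (intro eq_matI) (auto simp: Diag_def mat_diag_def)
  then have "?C\<^sup>T = ?C"
    using U(1) by (simp add: rotate_transpose)
  then have C: "feasible p \<kappa> ?C"
    using form_bounds_diag[OF U(1,3) d] \<mu> U(1)
    by (auto simp: feasible_iff_form_bounds[OF p \<kappa>])
  have gap: "frob_sq (?C - S) + frob_sq (A - ?C) \<le> frob_sq (A - S)" if "feasible p \<kappa> A" for A
  proof -
    obtain m where A: "A \<in> carrier_mat p p" and m: "0 < m" and b: "form_bounds p m (\<kappa> * m) A"
      using \<open>feasible p \<kappa> A\<close> by (auto simp: feasible_iff_form_bounds[OF p \<kappa>])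
    define B where "B = U\<^sup>T * A * U"
    have B: "B \<in> carrier_mat p p" using U(1) A by (simp add: B_def)
    have AB: "A = U * B * U\<^sup>T" using rotate_inverse[OF U(1,3) A] by (simp add: B_def)
    have "B $$ (i - 1, i - 1) \<in> {m..\<kappa> * m}" if "i \<in> {1..p}" for i
      unfolding B_def by (rule form_bounds_rotated_diag[OF U(1,2) A b]) (use that in auto)
    then have "0 \<le> (\<Sum>i=1..p. (d i - l i) * (B $$ (i - 1, i - 1) - d i))"
      by (rule variational[OF m])
    then have "frob_sq (Diag p d - Diag p l) + frob_sq (B - Diag p d) \<le> frob_sq (B - Diag p l)"
      using frob_sq_diag_expansion[OF B, of l d] by simp
    moreover have "?C - S = U * (Diag p d - Diag p l) * U\<^sup>T"
      unfolding S by (rule rotate_minus[OF U(1) D D])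
    moreover have "A - S = U * (B - Diag p l) * U\<^sup>T"
      unfolding AB S by (rule rotate_minus[OF U(1) B D])
    moreover have "A - ?C = U * (B - Diag p d) * U\<^sup>T"
      unfolding AB by (rule rotate_minus[OF U(1) B D])
    ultimately show ?thesis
      using B by (simp only: frob_sq_rotate[OF U(1,2)] minus_carrier_mat D)
  qed
  show ?thesis
  proof (intro equalityI subsetI)
    fix A assume "A \<in> solutions p \<kappa> S"
    then have A: "feasible p \<kappa> A" and "\<not> frobenius_norm (?C - S) < frobenius_norm (A - S)"
      using C by (auto simp: solutions_def is_arg_min_def)
    then have "frob_sq (A - ?C) = 0"
      using gap[OF A] frob_sq_nonneg[of "A - ?C"] by (simp add: frobenius_norm_sqrt)
    moreover have "A \<in> carrier_mat p p" using A by (simp add: feasible_def psd_cone_def)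
    ultimately show "A \<in> {?C}"
      using frob_sq_eq_0[of A ?C p p] mult_carrier_mat[of "U * Diag p d" p p "U\<^sup>T" p] U(1) by simp
  next
    fix A assume "A \<in> {?C}"
    moreover have "frobenius_norm (?C - S) \<le> frobenius_norm (B - S)" if "feasible p \<kappa> B" for B
      using gap[OF that] frob_sq_nonneg[of "B - ?C"] by (simp add: frobenius_norm_sqrt)
    ultimately show "A \<in> solutions p \<kappa> S"
      using C by (auto simp: solutions_def is_arg_min_def not_less)
  qed
qed

section \<open>Optimality of a consistently clipped spectrum\<close>

locale sorted_eigenvalues =
  fixes n p :: nat and \<kappa> :: real and lam :: "nat \<Rightarrow> real"
  assumes n_pos: "0 < n" and n_less_p: "n < p" and kappa_ge_1: "1 \<le> \<kappa>"
    and lam_antimono: "\<lbrakk>1 \<le> i; i \<le> j; j \<le> n\<rbrakk> \<Longrightarrow> lam j \<le> lam i"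
    and lam_n_pos: "0 < lam n"
    and lam_zero: "\<lbrakk>n + 1 \<le> i; i \<le> p\<rbrakk> \<Longrightarrow> lam i = 0"
begin

abbreviation \<mu> :: "nat \<Rightarrow> nat \<Rightarrow> real" where
  "\<mu> \<equiv> mu_star n p \<kappa> lam"

text \<open>
  The weighted sum of residuals \<open>\<kappa> \<Sum>i\<le>\<alpha>. (\<kappa> m - lam i) + \<Sum>i=\<beta>..p. (m - lam i)\<close>
  equals \<open>denom \<alpha> \<beta> * m - numer \<alpha> \<beta>\<close>, so that \<open>\<mu> \<alpha> \<beta>\<close> is its root.
\<close>

definition numer :: "nat \<Rightarrow> nat \<Rightarrow> real" where
  "numer \<alpha> \<beta> = \<kappa> * (\<Sum>i=1..\<alpha>. lam i) + (\<Sum>i=\<beta>..n. lam i)"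

definition denom :: "nat \<Rightarrow> nat \<Rightarrow> real" where
  "denom \<alpha> \<beta> = real \<alpha> * \<kappa>\<^sup>2 + real p - real \<beta> + 1"

text \<open>
  Consistency of a pair with its own threshold: clipping \<open>lam\<close> to
  \<open>[\<mu> \<alpha> \<beta>, \<kappa> * \<mu> \<alpha> \<beta>]\<close> cuts the positions up to
  \<open>\<alpha>\<close> down, raises those from \<open>\<beta>\<close> on, and changes nothing in between. Where \<open>lam\<close>
  has to be bounded below, monotonicity reduces this to the positions \<open>\<alpha>\<close> and \<open>\<beta> - 1\<close>.
\<close>

definition clip_pair :: "nat \<Rightarrow> nat \<Rightarrow> bool" where
  "clip_pair \<alpha> \<beta> \<longleftrightarrow> 1 \<le> \<alpha> \<and> \<alpha> < \<beta> \<and> \<beta> \<le> n + 1 \<and>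
     \<kappa> * \<mu> \<alpha> \<beta> \<le> lam \<alpha> \<and> \<mu> \<alpha> \<beta> \<le> lam (\<beta> - 1) \<and>
     (\<forall>i\<in>{\<alpha><..n}. lam i \<le> \<kappa> * \<mu> \<alpha> \<beta>) \<and> (\<forall>i\<in>{\<beta>..n}. lam i \<le> \<mu> \<alpha> \<beta>)"

lemma mu_eq: "\<mu> \<alpha> \<beta> = numer \<alpha> \<beta> / denom \<alpha> \<beta>"
  by (simp add: mu_star_def numer_def denom_def)

lemma lam_pos: "\<lbrakk>1 \<le> i; i \<le> n\<rbrakk> \<Longrightarrow> 0 < lam i"
  using lam_antimono[of i n] lam_n_pos by force

lemma denom_pos: "\<beta> \<le> n + 1 \<Longrightarrow> 0 < denom \<alpha> \<beta>"
proof -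
  assume "\<beta> \<le> n + 1"
  then have "0 < real p - real \<beta> + 1" using n_less_p by simp
  moreover have "0 \<le> real \<alpha> * \<kappa>\<^sup>2" by simp
  ultimately show ?thesis unfolding denom_def by linarith
qed

lemma mu_pos:
  assumes "1 \<le> \<alpha>" "\<alpha> \<le> n" "1 \<le> \<beta>" "\<beta> \<le> n + 1"
  shows "0 < \<mu> \<alpha> \<beta>"
proof -
  have "0 < (\<Sum>i=1..\<alpha>. lam i)"
    using assms lam_pos by (intro sum_pos) auto
  moreover have "0 \<le> (\<Sum>i=\<beta>..n. lam i)"
    using assms lam_pos by (intro sum_nonneg) (auto intro!: less_imp_le)
  ultimately have "0 < numer \<alpha> \<beta>"
    using kappa_ge_1 by (auto simp: numer_def intro!: add_pos_nonneg)
  then show ?thesis using denom_pos assms by (simp add: mu_eq)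
qed

definition clip :: "nat \<Rightarrow> nat \<Rightarrow> nat \<Rightarrow> real" where
  "clip \<alpha> \<beta> i = (if i \<le> \<alpha> then \<kappa> * \<mu> \<alpha> \<beta> else if i < \<beta> then lam i else \<mu> \<alpha> \<beta>)"

lemma Lambda_star_eq_clip: "Lambda_star n p \<kappa> lam \<alpha> \<beta> = Diag p (clip \<alpha> \<beta>)"
  by (simp add: Lambda_star_def clip_def[abs_def] Let_def)

lemma clip_in_range:
  assumes "clip_pair \<alpha> \<beta>"
  shows "clip \<alpha> \<beta> i \<in> {\<mu> \<alpha> \<beta>..\<kappa> * \<mu> \<alpha> \<beta>}"
proof -
  have b: "1 \<le> \<alpha>" "\<alpha> < \<beta>" "\<beta> \<le> n + 1" using assms by (auto simp: clip_pair_def)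
  then have "\<mu> \<alpha> \<beta> \<le> \<kappa> * \<mu> \<alpha> \<beta>"
    using mult_right_mono[OF kappa_ge_1, of "\<mu> \<alpha> \<beta>"] mu_pos[of \<alpha> \<beta>] by simp
  moreover have "lam i \<in> {\<mu> \<alpha> \<beta>..\<kappa> * \<mu> \<alpha> \<beta>}" if "\<alpha> < i" "i < \<beta>"
  proof -
    have "lam (\<beta> - 1) \<le> lam i" using that b by (intro lam_antimono) auto
    then show ?thesis using that b assms by (auto simp: clip_pair_def)
  qed
  ultimately show ?thesis by (auto simp: clip_def)
qed

text \<open>
  With weight \<open>\<kappa>\<close> on the first block, \<open>0\<close> on the middle one and \<open>1\<close> on the last, let
  \<open>g i\<close> be the weighted residual. The clipped value is \<open>\<mu>\<close> times the weight wherever the residual is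
  nonzero, and the sign of the residual bounds its product with \<open>x i\<close> below by \<open>m * g i\<close>. So the
  sum in question is at least \<open>m - \<mu>\<close> times \<open>\<Sum>i. g i\<close>, and that sum is zero by the choice of
  \<open>\<mu>\<close>.
\<close>

lemma clip_variational:
  assumes cp: "clip_pair \<alpha> \<beta>" and m: "0 < m"
    and x: "\<And>i. i \<in> {1..p} \<Longrightarrow> x i \<in> {m..\<kappa> * m}"
  shows "0 \<le> (\<Sum>i=1..p. (clip \<alpha> \<beta> i - lam i) * (x i - clip \<alpha> \<beta> i))"
proof -
  have b: "1 \<le> \<alpha>" "\<alpha> < \<beta>" "\<beta> \<le> n + 1" using cp by (auto simp: clip_pair_def)
  \<comment> \<open>the clipped spectrum, up to the factor \<mu>, on the two outer blocks\<close>
  define w where "w i = (if i \<le> \<alpha> then \<kappa> else if i < \<beta> then 0 else 1)" for i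
  define g where "g i = w i * (clip \<alpha> \<beta> i - lam i)" for i
  have head: "clip \<alpha> \<beta> i \<le> lam i" if "1 \<le> i" "i \<le> \<alpha>" for i
    using that b cp lam_antimono[of i \<alpha>] by (auto simp: clip_def clip_pair_def)
  have tail: "lam i \<le> clip \<alpha> \<beta> i" if "\<beta> \<le> i" "i \<le> p" for i
  proof (cases "i \<le> n")
    case True
    then show ?thesis using that b cp by (auto simp: clip_def clip_pair_def)
  next
    case False
    then show ?thesis using that b mu_pos[of \<alpha> \<beta>] lam_zero[of i] by (simp add: clip_def)
  qed
  have "(clip \<alpha> \<beta> i - lam i) * clip \<alpha> \<beta> i = \<mu> \<alpha> \<beta> * g i" for i
    by (simp add: g_def w_def clip_def)
  moreover have "m * g i \<le> (clip \<alpha> \<beta> i - lam i) * x i" if i: "i \<in> {1..p}" for i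
  proof -
    consider "i \<le> \<alpha>" | "\<alpha> < i" "i < \<beta>" | "\<alpha> < i" "\<beta> \<le> i" by linarith
    then show ?thesis
    proof cases
      case 1
      then have "(clip \<alpha> \<beta> i - lam i) * (\<kappa> * m) \<le> (clip \<alpha> \<beta> i - lam i) * x i"
        using i x[OF i] head[of i] by (intro mult_left_mono_neg) auto
      then show ?thesis using 1 by (simp add: g_def w_def mult_ac)
    next
      case 2
      then show ?thesis by (simp add: g_def w_def clip_def)
    next
      case 3
      then have "(clip \<alpha> \<beta> i - lam i) * m \<le> (clip \<alpha> \<beta> i - lam i) * x i"
        using i x[OF i] tail[of i] by (intro mult_left_mono) auto
      then show ?thesis using 3 b by (simp add: g_def w_def mult_ac)
    qed
  qed
  ultimately have "(\<Sum>i=1..p. m * g i - \<mu> \<alpha> \<beta> * g i)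
      \<le> (\<Sum>i=1..p. (clip \<alpha> \<beta> i - lam i) * (x i - clip \<alpha> \<beta> i))"
    by (intro sum_mono) (simp add: right_diff_distrib)
  moreover have "(\<Sum>i=1..p. g i) = 0"
  proof -
    have "(\<Sum>i=1..p. g i) = (\<Sum>i\<in>{1..\<alpha>} \<union> {\<beta>..p}. g i)"
      using b n_less_p by (intro sum.mono_neutral_right) (auto simp: g_def w_def)
    also have "\<dots> = (\<Sum>i=1..\<alpha>. g i) + (\<Sum>i=\<beta>..p. g i)"
      using b by (intro sum.union_disjoint) auto
    also have "(\<Sum>i=1..\<alpha>. g i) = (\<Sum>i=1..\<alpha>. \<kappa> * (\<kappa> * \<mu> \<alpha> \<beta> - lam i))"
      by (intro sum.cong) (auto simp: g_def w_def clip_def)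
    also have "\<dots> = real \<alpha> * \<kappa>\<^sup>2 * \<mu> \<alpha> \<beta> - \<kappa> * (\<Sum>i=1..\<alpha>. lam i)"
      by (simp add: sum_subtractf power2_eq_square algebra_simps flip: sum_distrib_left)
    also have "(\<Sum>i=\<beta>..p. g i) = (\<Sum>i=\<beta>..p. \<mu> \<alpha> \<beta> - lam i)"
      using b by (intro sum.cong) (auto simp: g_def w_def clip_def)
    also have "\<dots> = (real p - real \<beta> + 1) * \<mu> \<alpha> \<beta> - (\<Sum>i=\<beta>..p. lam i)"
      using b n_less_p by (simp add: sum_subtractf of_nat_diff algebra_simps)
    also have "(\<Sum>i=\<beta>..p. lam i) = (\<Sum>i=\<beta>..n. lam i)"
      using b n_less_p lam_zero by (intro sum.mono_neutral_right) auto
    finally have "(\<Sum>i=1..p. g i) = \<mu> \<alpha> \<beta> * denom \<alpha> \<beta> - numer \<alpha> \<beta>"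
      by (simp add: numer_def denom_def algebra_simps)
    then show ?thesis using denom_pos[OF b(3), of \<alpha>] by (simp add: mu_eq)
  qed
  ultimately show ?thesis by (simp add: sum_subtractf flip: sum_distrib_left)
qed

theorem solutions_clip_pair:
  assumes "spectral_decomposition p S U lam" and cp: "clip_pair \<alpha> \<beta>"
  shows "solutions p \<kappa> S = {U * Lambda_star n p \<kappa> lam \<alpha> \<beta> * U\<^sup>T}"
proof -
  have b: "1 \<le> \<alpha>" "\<alpha> < \<beta>" "\<beta> \<le> n + 1" using cp by (auto simp: clip_pair_def)
  show ?thesis
    unfolding Lambda_star_eq_clip
  proof (rule solutions_diag)
    show "0 < \<mu> \<alpha> \<beta>" using b by (intro mu_pos) auto
  qed (use assms kappa_ge_1 n_less_p clip_in_range[OF cp] clip_variational[OF cp]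
      in \<open>auto simp: spectral_decomposition_def\<close>)
qed

end

section \<open>A linear scan for the clipping indices\<close>

context sorted_eigenvalues
begin

text \<open>
  The scan has passed the breakpoints of all positions above \<open>\<alpha>\<close> (for the upper bound) and
  from \<open>\<beta>\<close> on (for the lower bound), and the threshold is not below any of them. The last conjunct
  records that breakpoints are passed in increasing order: \<open>lam i / \<kappa>\<close>, for \<open>i > \<alpha>\<close>, is
  at most the pending breakpoint \<open>lam (\<beta> - 1)\<close>. It is needed because
  passing a breakpoint of the second kind may lower \<open>\<mu>\<close>.
\<close>

definition search_inv :: "nat \<Rightarrow> nat \<Rightarrow> bool" where
  "search_inv \<alpha> \<beta> \<longleftrightarrow> 1 \<le> \<alpha> \<and> \<alpha> < \<beta> \<and> \<beta> \<le> n + 1 \<and>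
     (\<forall>i\<in>{\<alpha><..n}. lam i \<le> \<kappa> * \<mu> \<alpha> \<beta>) \<and> (\<forall>i\<in>{\<beta>..n}. lam i \<le> \<mu> \<alpha> \<beta>) \<and>
     (\<forall>i\<in>{\<alpha><..n}. lam i \<le> \<kappa> * lam (\<beta> - 1))"

lemma search_inv_init: "search_inv n (n + 1)"
  using n_pos by (auto simp: search_inv_def)

text \<open>
  The term \<open>\<kappa> (\<kappa> m - lam \<alpha>)\<close> that leaves the sum of residuals is nonnegative at
  \<open>m = \<mu> \<alpha> \<beta>\<close>, hence the new sum is nonpositive there and its root lies further right.
\<close>

lemma mu_drop_head:
  assumes "1 \<le> \<alpha>" "\<beta> \<le> n + 1" "lam \<alpha> \<le> \<kappa> * \<mu> \<alpha> \<beta>"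
  shows "\<mu> \<alpha> \<beta> \<le> \<mu> (\<alpha> - 1) \<beta>"
proof -
  have D: "0 < denom \<alpha> \<beta>" "0 < denom (\<alpha> - 1) \<beta>" using denom_pos assms by auto
  have "{1..\<alpha>} = insert \<alpha> {1..\<alpha> - 1}" using assms by auto
  then have N: "numer (\<alpha> - 1) \<beta> = numer \<alpha> \<beta> - \<kappa> * lam \<alpha>"
    using assms by (simp add: numer_def algebra_simps)
  have D': "denom (\<alpha> - 1) \<beta> = denom \<alpha> \<beta> - \<kappa>\<^sup>2"
    using assms by (simp add: denom_def of_nat_diff algebra_simps)
  have "lam \<alpha> * denom \<alpha> \<beta> \<le> \<kappa> * numer \<alpha> \<beta>"
    using assms(3) D by (simp add: mu_eq field_simps)
  then have "\<kappa> * (lam \<alpha> * denom \<alpha> \<beta>) \<le> \<kappa> * (\<kappa> * numer \<alpha> \<beta>)"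
    using kappa_ge_1 by (intro mult_left_mono) auto
  then have "numer \<alpha> \<beta> * denom (\<alpha> - 1) \<beta> \<le> numer (\<alpha> - 1) \<beta> * denom \<alpha> \<beta>"
    unfolding N D' by (simp add: algebra_simps power2_eq_square)
  then show ?thesis using D by (simp add: mu_eq divide_le_eq le_divide_eq)
qed

text \<open>
  The term \<open>m - lam (\<beta> - 1)\<close> that joins the sum of residuals vanishes at
  \<open>m = lam (\<beta> - 1)\<close>, where the old sum is nonpositive, so the new root is not to the left of that
  point, although it may be smaller than the old one.
\<close>

lemma mu_extend_tail:
  assumes "2 \<le> \<beta>" "\<beta> \<le> n + 1" "lam (\<beta> - 1) \<le> \<mu> \<alpha> \<beta>"
  shows "lam (\<beta> - 1) \<le> \<mu> \<alpha> (\<beta> - 1)"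
proof -
  have D: "0 < denom \<alpha> \<beta>" "0 < denom \<alpha> (\<beta> - 1)" using denom_pos assms by auto
  have "{\<beta> - 1..n} = insert (\<beta> - 1) {\<beta>..n}" using assms by auto
  then have N: "numer \<alpha> (\<beta> - 1) = numer \<alpha> \<beta> + lam (\<beta> - 1)"
    using assms by (simp add: numer_def)
  have D': "denom \<alpha> (\<beta> - 1) = denom \<alpha> \<beta> + 1"
    using assms by (simp add: denom_def of_nat_diff)
  have "lam (\<beta> - 1) * denom \<alpha> \<beta> \<le> numer \<alpha> \<beta>"
    using assms(3) D by (simp add: mu_eq field_simps)
  then have "lam (\<beta> - 1) * denom \<alpha> (\<beta> - 1) \<le> numer \<alpha> (\<beta> - 1)"
    unfolding N D' by (simp add: distrib_left)
  then show ?thesis unfolding mu_eq pos_le_divide_eq[OF D(2)] .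
qed

text \<open>
  Here \<open>n < p\<close> matters: if \<open>\<kappa> \<mu>\<close> exceeded the largest eigenvalue, no residual would be
  negative, and the \<open>p - n\<close> zero eigenvalues would contribute positive ones, so the residuals could
  not cancel.
\<close>

lemma head_not_exhausted:
  assumes "search_inv 1 \<beta>"
  shows "\<kappa> * \<mu> 1 \<beta> \<le> lam 1"
proof (rule ccontr)
  assume *: "\<not> ?thesis"
  let ?m = "\<mu> 1 \<beta>"
  have b: "1 < \<beta>" "\<beta> \<le> n + 1" and t: "\<And>i. i \<in> {\<beta>..n} \<Longrightarrow> lam i \<le> ?m"
    using assms by (auto simp: search_inv_def)
  have "0 < ?m" using mu_pos b n_pos by auto
  have "(\<Sum>i=\<beta>..n. lam i) \<le> (\<Sum>i=\<beta>..n. ?m)" using t by (intro sum_mono)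
  also have "\<dots> = (real n + 1 - real \<beta>) * ?m" using b by (simp add: of_nat_diff)
  finally have "numer 1 \<beta> \<le> \<kappa> * lam 1 + (real n + 1 - real \<beta>) * ?m"
    by (simp add: numer_def)
  moreover have "numer 1 \<beta> = ?m * denom 1 \<beta>"
    using denom_pos[of \<beta> 1] b by (simp add: mu_eq)
  moreover have "\<kappa> * lam 1 < \<kappa> * (\<kappa> * ?m)"
    using * kappa_ge_1 by (intro mult_strict_left_mono) auto
  ultimately have "?m * (real p - real n) < 0"
    by (simp add: denom_def algebra_simps power2_eq_square)
  then show False using \<open>0 < ?m\<close> n_less_p by (simp add: mult_less_0_iff)
qed

text \<open>
  The next two lemmas treat the two kinds of pending breakpoint: once the threshold is not beyond the
  smaller of \<open>lam \<alpha> / \<kappa>\<close> and \<open>lam (\<beta> - 1)\<close>, it is not beyond the other one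
  either.
\<close>

lemma stop_head:
  assumes "search_inv \<alpha> \<beta>" "lam \<alpha> \<le> \<kappa> * lam (\<beta> - 1)" "\<kappa> * \<mu> \<alpha> \<beta> \<le> lam \<alpha>"
  shows "clip_pair \<alpha> \<beta>"
proof -
  have "\<kappa> * \<mu> \<alpha> \<beta> \<le> \<kappa> * lam (\<beta> - 1)" using assms by linarith
  then have "\<mu> \<alpha> \<beta> \<le> lam (\<beta> - 1)" using kappa_ge_1 by simp
  then show ?thesis using assms by (simp add: clip_pair_def search_inv_def)
qed

lemma stop_tail:
  assumes "search_inv \<alpha> \<beta>" "\<not> lam \<alpha> \<le> \<kappa> * lam (\<beta> - 1)" "\<mu> \<alpha> \<beta> \<le> lam (\<beta> - 1)"
  shows "clip_pair \<alpha> \<beta>"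
proof -
  have "\<kappa> * \<mu> \<alpha> \<beta> \<le> \<kappa> * lam (\<beta> - 1)" using assms kappa_ge_1 by (intro mult_left_mono) auto
  then show ?thesis using assms by (simp add: clip_pair_def search_inv_def)
qed

lemma step_head:
  assumes inv: "search_inv \<alpha> \<beta>" and le: "lam \<alpha> \<le> \<kappa> * lam (\<beta> - 1)"
    and gt: "\<not> \<kappa> * \<mu> \<alpha> \<beta> \<le> lam \<alpha>"
  shows "search_inv (\<alpha> - 1) \<beta>"
proof -
  have "\<alpha> \<noteq> 1" using head_not_exhausted inv gt by auto
  have mono: "\<mu> \<alpha> \<beta> \<le> \<mu> (\<alpha> - 1) \<beta>"
    using inv gt by (intro mu_drop_head) (auto simp: search_inv_def)
  then have kmono: "\<kappa> * \<mu> \<alpha> \<beta> \<le> \<kappa> * \<mu> (\<alpha> - 1) \<beta>"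
    using kappa_ge_1 by (intro mult_left_mono) auto
  have "lam i \<le> \<kappa> * \<mu> \<alpha> \<beta> \<and> lam i \<le> \<kappa> * lam (\<beta> - 1)" if "i \<in> {\<alpha> - 1<..n}" for i
    using inv le gt that unfolding search_inv_def by (cases "i = \<alpha>") auto
  moreover have "lam i \<le> \<mu> \<alpha> \<beta>" if "i \<in> {\<beta>..n}" for i
    using inv that unfolding search_inv_def by blast
  moreover have "1 \<le> \<alpha> - 1" "\<alpha> - 1 < \<beta>" "\<beta> \<le> n + 1"
    using inv \<open>\<alpha> \<noteq> 1\<close> unfolding search_inv_def by auto
  ultimately show ?thesis
    using mono kmono unfolding search_inv_def by (meson order_trans)
qed

text \<open>
  The case distinction also keeps the indices apart: if \<open>\<alpha>\<close> were \<open>\<beta> - 1\<close>, then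
  \<open>lam \<alpha> / \<kappa>\<close> could not be the larger breakpoint, as \<open>\<kappa>\<close> is at least 1.
\<close>

lemma step_tail:
  assumes inv: "search_inv \<alpha> \<beta>" and gt: "\<not> lam \<alpha> \<le> \<kappa> * lam (\<beta> - 1)"
    and gt': "\<not> \<mu> \<alpha> \<beta> \<le> lam (\<beta> - 1)"
  shows "search_inv \<alpha> (\<beta> - 1)"
proof -
  have b: "1 \<le> \<alpha>" "\<alpha> < \<beta>" "\<beta> \<le> n + 1" using inv by (auto simp: search_inv_def)
  have "lam (\<beta> - 1) \<le> \<kappa> * lam (\<beta> - 1)"
    using mult_right_mono[OF kappa_ge_1, of "lam (\<beta> - 1)"] lam_pos[of "\<beta> - 1"] b kappa_ge_1 by simp
  then have ne: "\<alpha> \<noteq> \<beta> - 1" using gt by auto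
  have tail: "lam (\<beta> - 1) \<le> \<mu> \<alpha> (\<beta> - 1)"
    using b gt' by (intro mu_extend_tail) auto
  have "lam (\<beta> - 1) \<le> lam (\<beta> - 1 - 1)" using b ne by (intro lam_antimono) auto
  then have "\<kappa> * lam (\<beta> - 1) \<le> \<kappa> * lam (\<beta> - 1 - 1)" "\<kappa> * lam (\<beta> - 1) \<le> \<kappa> * \<mu> \<alpha> (\<beta> - 1)"
    using tail kappa_ge_1 by (auto intro!: mult_left_mono)
  moreover have "lam i \<le> \<kappa> * lam (\<beta> - 1)" if "i \<in> {\<alpha><..n}" for i
    using inv that by (auto simp: search_inv_def)
  moreover have "lam i \<le> lam (\<beta> - 1)" if "i \<in> {\<beta> - 1..n}" for i
    using that b by (intro lam_antimono) auto
  moreover have "\<alpha> < \<beta> - 1" "\<beta> - 1 \<le> n + 1" using b ne by auto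
  ultimately show ?thesis
    using b(1) tail unfolding search_inv_def by (meson order_trans)
qed

end

section \<open>Running programs within a budget of operations\<close>

text \<open>
  Execution with a budget of \<open>N\<close> operations; the postcondition also sees the unspent part. This
  form makes sequential composition a plain nesting of postconditions, without existentially
  quantified step counts.
\<close>

definition runs :: "real list \<Rightarrow> com \<Rightarrow> state \<Rightarrow> nat \<Rightarrow> (state \<Rightarrow> nat \<Rightarrow> bool) \<Rightarrow> bool" where
  "runs xs c s N Q \<longleftrightarrow> (\<exists>k t. exec xs c s k t \<and> k \<le> N \<and> Q t (N - k))"

lemma runs_mono:
  "runs xs c s N Q \<Longrightarrow> (\<And>t M. Q t M \<Longrightarrow> Q' t M) \<Longrightarrow> runs xs c s N Q'"
  unfolding runs_def by blast

lemma runs_Skip: "Q s N \<Longrightarrow> runs xs Skip s N Q"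
  unfolding runs_def by (force intro: exec.Skip)

lemma runs_Put: "Q (s(r := real_of_int c)) N \<Longrightarrow> runs xs (Put r c) s N Q"
  unfolding runs_def by (force intro: exec.Put)

lemma runs_Move: "Q (s(r := s a)) N \<Longrightarrow> runs xs (Move r a) s N Q"
  unfolding runs_def by (force intro: exec.Move)

lemma runs_Load:
  "\<lbrakk>s a = real i; 1 \<le> i; i \<le> length xs; Q (s(r := xs ! (i - 1))) N\<rbrakk>
    \<Longrightarrow> runs xs (Load r a) s N Q"
  unfolding runs_def using exec.Load[of s a i xs r] by force

lemma runs_Arith:
  "\<lbrakk>1 \<le> N; f = Divide \<Longrightarrow> s b \<noteq> 0; Q (s(r := apply_op f (s a) (s b))) (N - 1)\<rbrakk>
    \<Longrightarrow> runs xs (Arith r f a b) s N Q"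
  unfolding runs_def using exec.Arith[of f s b xs r a] by force

lemma runs_Seq:
  assumes "runs xs c1 s N (\<lambda>t M. runs xs c2 t M Q)"
  shows "runs xs (Seq c1 c2) s N Q"
proof -
  obtain k s' l t where "exec xs c1 s k s'" "k \<le> N" "exec xs c2 s' l t" "l \<le> N - k"
      "Q t (N - k - l)"
    using assms unfolding runs_def by blast
  then show ?thesis unfolding runs_def by (intro exI[of _ "k + l"] exI[of _ t]) (auto intro: exec.Seq)
qed

lemma runs_Cond:
  assumes "1 \<le> N" "compare q (s a) (s b) \<Longrightarrow> runs xs c1 s (N - 1) Q"
    "\<not> compare q (s a) (s b) \<Longrightarrow> runs xs c2 s (N - 1) Q"
  shows "runs xs (Cond a q b c1 c2) s N Q"
proof -
  obtain k t where k: "exec xs (if compare q (s a) (s b) then c1 else c2) s k t" "k \<le> N - 1"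
      "Q t (N - 1 - k)"
    using assms unfolding runs_def by (cases "compare q (s a) (s b)") auto
  then show ?thesis using assms(1) unfolding runs_def
    by (intro exI[of _ "Suc k"] exI[of _ t])
      (auto split: if_splits intro: exec.CondTrue exec.CondFalse)
qed

text \<open>
  The invariant carries a bound \<open>m\<close> on the number of remaining rounds. Every round costs
  one comparison besides its body, and one more comparison ends the loop.
\<close>

lemma runs_While:
  assumes "I m s"
    and step: "\<And>m s. I m s \<Longrightarrow> compare q (s a) (s b) \<Longrightarrow>
      runs xs c s K (\<lambda>t _. \<exists>m'<m. I m' t)"
    and "(K + 1) * m + 1 \<le> N"
    and "\<And>m' t M. I m' t \<Longrightarrow> \<not> compare q (t a) (t b) \<Longrightarrow> N \<le> M + ((K + 1) * m + 1) \<Longrightarrow> Q t M"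
  shows "runs xs (While a q b c) s N Q"
proof -
  have "\<exists>k t m'. exec xs (While a q b c) s k t \<and> k \<le> (K + 1) * m + 1 \<and> I m' t \<and>
      \<not> compare q (t a) (t b)"
    using \<open>I m s\<close>
  proof (induction m arbitrary: s rule: less_induct)
    case (less m)
    show ?case
    proof (cases "compare q (s a) (s b)")
      case True
      obtain k s' m' where k: "exec xs c s k s'" "k \<le> K" "m' < m" "I m' s'"
        using step[OF less.prems True] unfolding runs_def by blast
      from less.IH[OF k(3,4)] obtain l t m'' where l: "exec xs (While a q b c) s' l t"
        "l \<le> (K + 1) * m' + 1" "I m'' t" "\<not> compare q (t a) (t b)" by blast
      have "(K + 1) * (m' + 1) \<le> (K + 1) * m" using k(3) by (intro mult_le_mono2) auto
      then have "Suc (k + l) \<le> (K + 1) * m + 1" using k(2) l(2) by (simp add: algebra_simps)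
      then show ?thesis using exec.WhileTrue[OF True k(1) l(1)] l by blast
    next
      case False
      then show ?thesis using exec.WhileFalse[of q s a b xs c] less.prems by fastforce
    qed
  qed
  then obtain k t m' where "exec xs (While a q b c) s k t" "k \<le> (K + 1) * m + 1" "I m' t"
    "\<not> compare q (t a) (t b)" by blast
  moreover from this have "Q t (N - k)" using assms by auto
  ultimately show ?thesis unfolding runs_def using assms(3) order_trans by blast
qed

definition seqs :: "com list \<Rightarrow> com" where
  "seqs cs = foldr Seq cs Skip"

lemma runs_seqs_Nil: "Q s N \<Longrightarrow> runs xs (seqs []) s N Q"
  by (simp add: seqs_def runs_Skip)

lemma runs_seqs_Cons:
  "runs xs c s N (\<lambda>t M. runs xs (seqs cs) t M Q) \<Longrightarrow> runs xs (seqs (c # cs)) s N Q"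
  by (simp add: seqs_def runs_Seq)

lemmas runs_straight = runs_seqs_Nil runs_seqs_Cons runs_Put runs_Move runs_Arith runs_Cond

section \<open>The search program\<close>

text \<open>
  Registers 0, 1 and 2 hold \<open>n\<close>, \<open>p\<close> and \<open>\<kappa>\<close> at the start, and registers 0 and 1
  hold the result. \<open>reg_head\<close> and \<open>reg_tail\<close> maintain the two sums in the numerator of
  \<open>\<mu>\<close>; \<open>reg_pred\<close> is \<open>\<beta> - 1\<close>, the position whose lower bound is pending.
\<close>

abbreviation (input) "reg_alpha \<equiv> 0 :: nat"
abbreviation (input) "reg_beta \<equiv> 1 :: nat"
abbreviation (input) "reg_kappa \<equiv> 2 :: nat"
abbreviation (input) "reg_p \<equiv> 3 :: nat"
abbreviation (input) "reg_head \<equiv> 4 :: nat"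
abbreviation (input) "reg_tail \<equiv> 5 :: nat"
abbreviation (input) "reg_done \<equiv> 6 :: nat"
abbreviation (input) "reg_one \<equiv> 7 :: nat"
abbreviation (input) "reg_pred \<equiv> 8 :: nat"
abbreviation (input) "reg_lam_alpha \<equiv> 9 :: nat"
abbreviation (input) "reg_lam_pred \<equiv> 10 :: nat"
abbreviation (input) "reg_mu \<equiv> 11 :: nat"
abbreviation (input) "reg_tmp \<equiv> 12 :: nat"
abbreviation (input) "reg_kappa_mu \<equiv> 13 :: nat"

definition sum_body :: com where
  "sum_body = seqs
    [Arith reg_tmp Plus reg_tmp reg_one,
     Load reg_lam_alpha reg_tmp,
     Arith reg_head Plus reg_head reg_lam_alpha]"

definition evaluate_pair :: com where
  "evaluate_pair = seqs
    [Arith reg_pred Minus reg_beta reg_one,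
     Load reg_lam_alpha reg_alpha,
     Load reg_lam_pred reg_pred,
     Arith reg_mu Times reg_kappa reg_head,
     Arith reg_mu Plus reg_mu reg_tail,
     Arith reg_tmp Times reg_kappa reg_kappa,
     Arith reg_tmp Times reg_alpha reg_tmp,
     Arith reg_tmp Plus reg_tmp reg_p,
     Arith reg_tmp Minus reg_tmp reg_pred,
     Arith reg_mu Divide reg_mu reg_tmp,
     Arith reg_kappa_mu Times reg_kappa reg_mu,
     Arith reg_tmp Times reg_kappa reg_lam_pred]"

definition search_body :: com where
  "search_body = seqs
    [evaluate_pair,
     Cond reg_lam_alpha Le reg_tmp
       (Cond reg_kappa_mu Le reg_lam_alpha
         (Put reg_done 1)
         (seqs [Arith reg_head Minus reg_head reg_lam_alpha,
                Arith reg_alpha Minus reg_alpha reg_one]))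
       (Cond reg_mu Le reg_lam_pred
         (Put reg_done 1)
         (seqs [Arith reg_tail Plus reg_tail reg_lam_pred,
                Move reg_beta reg_pred]))]"

text \<open>
  The first loop leaves the sum of the whole array in \<open>reg_head\<close> and uses \<open>reg_tmp\<close> as its
  counter. Register 1 is saved before it is reused for \<open>\<beta>\<close>.
\<close>

definition search_program :: com where
  "search_program = seqs
    [Move reg_p 1,
     Put reg_one 1,
     Put reg_tmp 0,
     Put reg_head 0,
     Put reg_tail 0,
     Put reg_done 0,
     While reg_tmp Less reg_alpha sum_body,
     Arith reg_beta Plus reg_alpha reg_one,
     While reg_done Less reg_one search_body]"

context sorted_eigenvalues
begin

definition input :: "real list" where
  "input = map lam [1..<Suc n]"

lemma runs_Load_input:
  "\<lbrakk>s a = real i; 1 \<le> i; i \<le> n; Q (s(r := lam i)) N\<rbrakk> \<Longrightarrow> runs input (Load r a) s N Q"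
  by (rule runs_Load[of s a i]) (simp_all add: input_def del: upt_Suc)

definition sum_inv :: "nat \<Rightarrow> state \<Rightarrow> bool" where
  "sum_inv m s \<longleftrightarrow> (\<exists>j\<le>n. m = n - j \<and> s reg_tmp = real j \<and> s reg_head = (\<Sum>i=1..j. lam i) \<and>
     s reg_alpha = real n \<and> s reg_kappa = \<kappa> \<and> s reg_p = real p \<and> s reg_tail = 0 \<and>
     s reg_done = 0 \<and> s reg_one = 1)"

definition registers :: "nat \<Rightarrow> nat \<Rightarrow> state \<Rightarrow> bool" where
  "registers \<alpha> \<beta> s \<longleftrightarrow> s reg_alpha = real \<alpha> \<and> s reg_beta = real \<beta> \<and>
     s reg_kappa = \<kappa> \<and> s reg_p = real p \<and> s reg_one = 1 \<and>
     s reg_head = (\<Sum>i=1..\<alpha>. lam i) \<and> s reg_tail = (\<Sum>i=\<beta>..n. lam i)"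

text \<open>
  A further round is only started while the flag is 0, and unless it sets the flag it lowers
  \<open>\<alpha> + \<beta>\<close>, so this sum bounds the remaining rounds.
\<close>

definition loop_inv :: "nat \<Rightarrow> state \<Rightarrow> bool" where
  "loop_inv m s \<longleftrightarrow> (\<exists>\<alpha> \<beta>. registers \<alpha> \<beta> s \<and>
     (s reg_done = 0 \<and> m = \<alpha> + \<beta> \<and> search_inv \<alpha> \<beta> \<or> s reg_done = 1 \<and> m = 0 \<and> clip_pair \<alpha> \<beta>))"

lemma runs_sum_body:
  assumes "sum_inv m s" "s reg_tmp < s reg_alpha"
  shows "runs input sum_body s 2 (\<lambda>t _. \<exists>m'<m. sum_inv m' t)"
proof -
  obtain j where j: "j < n" "m = n - j" "s reg_tmp = real j" "s reg_head = (\<Sum>i=1..j. lam i)"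
     "s reg_alpha = real n" "s reg_kappa = \<kappa>" "s reg_p = real p" "s reg_tail = 0"
     "s reg_done = 0" "s reg_one = 1"
    using assms by (auto simp: sum_inv_def)
  show ?thesis unfolding sum_body_def
    apply (intro runs_straight)
      apply (simp_all)
    apply (rule runs_Load_input[of _ _ "j + 1"])
    using j apply (simp_all)
    apply (intro runs_straight)
      apply simp_all
    apply (rule exI[of _ "n - (j + 1)"])
    using j apply (auto simp: sum_inv_def intro!: exI[of _ "j + 1"])
    done
qed

definition evaluated :: "nat \<Rightarrow> nat \<Rightarrow> state \<Rightarrow> bool" where
  "evaluated \<alpha> \<beta> s \<longleftrightarrow> registers \<alpha> \<beta> s \<and> s reg_done = 0 \<and>
     s reg_pred = real (\<beta> - 1) \<and> s reg_lam_alpha = lam \<alpha> \<and> s reg_lam_pred = lam (\<beta> - 1) \<and>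
     s reg_mu = \<mu> \<alpha> \<beta> \<and> s reg_kappa_mu = \<kappa> * \<mu> \<alpha> \<beta> \<and> s reg_tmp = \<kappa> * lam (\<beta> - 1)"

text \<open>
  The preparation of a round consists of ten operations and leaves four of the budget for the
  comparisons and updates that follow.
\<close>

lemma runs_evaluate_pair:
  assumes regs: "registers \<alpha> \<beta> s" "s reg_done = 0" and b: "1 \<le> \<alpha>" "\<alpha> < \<beta>" "\<beta> \<le> n + 1"
  shows "runs input evaluate_pair s 14 (\<lambda>t M. evaluated \<alpha> \<beta> t \<and> M = 4)"
proof -
  have den: "real \<alpha> * (\<kappa> * \<kappa>) + real p - (real \<beta> - 1) = denom \<alpha> \<beta>"
    by (simp add: denom_def power2_eq_square)
  have num: "\<kappa> * (\<Sum>i=Suc 0..\<alpha>. lam i) + (\<Sum>i=\<beta>..n. lam i) = numer \<alpha> \<beta>"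
    by (simp add: numer_def)
  have mu: "numer \<alpha> \<beta> / denom \<alpha> \<beta> = \<mu> \<alpha> \<beta>" by (simp add: mu_eq)
  have den0: "denom \<alpha> \<beta> \<noteq> 0" using denom_pos[of \<beta> \<alpha>] b by simp
  note regs' = regs[unfolded registers_def, simplified]
  note step = regs' den num mu den0
  have pred: "real \<beta> - 1 = real (\<beta> - Suc 0)" using b by simp
  show ?thesis unfolding evaluate_pair_def
    \<comment> \<open>register contents are simplified after every instruction, since the symbolic
      state would otherwise double in size at each of them\<close>
    apply (rule runs_seqs_Cons, rule runs_Arith, simp, simp, simp add: step)
    apply (rule runs_seqs_Cons, rule runs_Load_input[of _ _ \<alpha>], simp add: step, use b in simp, use b in simp, (simp add: step)?)
    apply (rule runs_seqs_Cons, rule runs_Load_input[of _ _ "\<beta> - 1"], simp add: pred, use b in simp, use b in simp, (simp add: step)?)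
    apply (rule runs_seqs_Cons, rule runs_Arith, simp, simp add: step, simp add: step)+
    apply (rule runs_seqs_Nil)
    apply (simp add: evaluated_def registers_def step pred)
    done
qed

lemma runs_search_body:
  assumes inv: "loop_inv m s" and go: "s reg_done < s reg_one"
  shows "runs input search_body s 14 (\<lambda>t _. \<exists>m'<m. loop_inv m' t)"
proof -
  obtain \<alpha> \<beta> where regs: "registers \<alpha> \<beta> s" and d: "s reg_done = 0" and m: "m = \<alpha> + \<beta>"
    and si: "search_inv \<alpha> \<beta>"
    using inv go by (auto simp: loop_inv_def registers_def)
  have b: "1 \<le> \<alpha>" "\<alpha> < \<beta>" "\<beta> \<le> n + 1" using si by (auto simp: search_inv_def)
  have "{1..\<alpha>} = insert \<alpha> {1..\<alpha> - 1}" using b by auto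
  then have head: "(\<Sum>i=1..\<alpha>. lam i) - lam \<alpha> = (\<Sum>i=1..\<alpha>-1. lam i)" using b by simp
  have "{\<beta> - 1..n} = insert (\<beta> - 1) {\<beta>..n}" using b by auto
  then have tail: "(\<Sum>i=\<beta>..n. lam i) + lam (\<beta> - 1) = (\<Sum>i=\<beta>-1..n. lam i)" using b by simp
  let ?Q = "\<lambda>t (_ :: nat). \<exists>m'<m. loop_inv m' t"
  let ?stop = "Put reg_done 1"
  let ?drop = "seqs [Arith reg_head Minus reg_head reg_lam_alpha,
      Arith reg_alpha Minus reg_alpha reg_one]"
  let ?extend = "seqs [Arith reg_tail Plus reg_tail reg_lam_pred, Move reg_beta reg_pred]"
  have stop: "runs input ?stop t 2 ?Q" if t: "evaluated \<alpha> \<beta> t" and cp: "clip_pair \<alpha> \<beta>" for t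
  proof (rule runs_Put)
    have "loop_inv 0 (t(reg_done := real_of_int 1))"
      using t cp unfolding loop_inv_def evaluated_def registers_def by auto
    then show "\<exists>m'<m. loop_inv m' (t(reg_done := real_of_int 1))" using b m by auto
  qed
  have drop: "runs input ?drop t 2 ?Q"
    if t: "evaluated \<alpha> \<beta> t" and si': "search_inv (\<alpha> - 1) \<beta>" for t
  proof -
    have "loop_inv (\<alpha> - 1 + \<beta>) (t(reg_head := t reg_head - t reg_lam_alpha,
        reg_alpha := t reg_alpha - t reg_one))"
      using t si' b head unfolding loop_inv_def evaluated_def registers_def
      by (intro exI[of _ "\<alpha> - 1"] exI[of _ \<beta>]) simp
    moreover have "\<alpha> - 1 + \<beta> < m" using b m by simp
    ultimately have "\<exists>m'<m. loop_inv m' (t(reg_head := t reg_head - t reg_lam_alpha,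
        reg_alpha := t reg_alpha - t reg_one))" by blast
    then show ?thesis by (intro runs_straight) simp_all
  qed
  have extend: "runs input ?extend t 2 ?Q"
    if t: "evaluated \<alpha> \<beta> t" and si': "search_inv \<alpha> (\<beta> - 1)" for t
  proof -
    have "loop_inv (\<alpha> + (\<beta> - 1)) (t(reg_tail := t reg_tail + t reg_lam_pred,
        reg_beta := t reg_pred))"
      using t si' b tail unfolding loop_inv_def evaluated_def registers_def
      by (intro exI[of _ \<alpha>] exI[of _ "\<beta> - 1"]) simp
    moreover have "\<alpha> + (\<beta> - 1) < m" using b m by simp
    ultimately have "\<exists>m'<m. loop_inv m' (t(reg_tail := t reg_tail + t reg_lam_pred,
        reg_beta := t reg_pred))" by blast
    then show ?thesis by (intro runs_straight) simp_all
  qed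
  have decide: "runs input
      (seqs [Cond reg_lam_alpha Le reg_tmp
         (Cond reg_kappa_mu Le reg_lam_alpha ?stop ?drop)
         (Cond reg_mu Le reg_lam_pred ?stop ?extend)]) t 4 ?Q"
    if t: "evaluated \<alpha> \<beta> t" for t
  proof (rule runs_seqs_Cons, rule runs_mono)
    have vals: "t reg_lam_alpha = lam \<alpha>" "t reg_lam_pred = lam (\<beta> - 1)" "t reg_mu = \<mu> \<alpha> \<beta>"
        "t reg_kappa_mu = \<kappa> * \<mu> \<alpha> \<beta>" "t reg_tmp = \<kappa> * lam (\<beta> - 1)"
      using t by (simp_all add: evaluated_def)
    show "runs input (Cond reg_lam_alpha Le reg_tmp
         (Cond reg_kappa_mu Le reg_lam_alpha ?stop ?drop)
         (Cond reg_mu Le reg_lam_pred ?stop ?extend)) t 4 ?Q"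
    proof (rule runs_Cond)
      assume "compare Le (t reg_lam_alpha) (t reg_tmp)"
      then have le: "lam \<alpha> \<le> \<kappa> * lam (\<beta> - 1)" by (simp add: vals)
      show "runs input (Cond reg_kappa_mu Le reg_lam_alpha ?stop ?drop) t (4 - 1) ?Q"
        using stop[OF t stop_head[OF si le]] drop[OF t step_head[OF si le]]
        by (intro runs_Cond) (simp_all add: vals)
    next
      assume "\<not> compare Le (t reg_lam_alpha) (t reg_tmp)"
      then have gt: "\<not> lam \<alpha> \<le> \<kappa> * lam (\<beta> - 1)" by (simp add: vals)
      show "runs input (Cond reg_mu Le reg_lam_pred ?stop ?extend) t (4 - 1) ?Q"
        using stop[OF t stop_tail[OF si gt]] extend[OF t step_tail[OF si gt]]
        by (intro runs_Cond) (simp_all add: vals)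
    qed simp
  qed (rule runs_seqs_Nil)
  show ?thesis unfolding search_body_def
    using decide by (intro runs_seqs_Cons[OF runs_mono[OF runs_evaluate_pair[OF regs d b]]]) auto
qed

lemma runs_search_loop:
  assumes "registers n (n + 1) s" "s reg_done = 0" "30 * n + 16 \<le> N"
  shows "runs input (While reg_done Less reg_one search_body) s N
    (\<lambda>t _. \<exists>\<alpha> \<beta>. clip_pair \<alpha> \<beta> \<and> t reg_alpha = real \<alpha> \<and> t reg_beta = real \<beta>)"
proof (rule runs_While[where I = loop_inv and m = "2 * n + 1" and K = 14])
  show "loop_inv (2 * n + 1) s"
    unfolding loop_inv_def using assms search_inv_init
    by (intro exI[of _ n] exI[of _ "n + 1"]) auto
next
  show "runs input search_body s 14 (\<lambda>t _. \<exists>m'<m. loop_inv m' t)"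
    if "loop_inv m s" "compare Less (s reg_done) (s reg_one)" for m s
    using that by (simp add: runs_search_body)
next
  show "\<exists>\<alpha> \<beta>. clip_pair \<alpha> \<beta> \<and> t reg_alpha = real \<alpha> \<and> t reg_beta = real \<beta>"
    if "loop_inv m t" "\<not> compare Less (t reg_done) (t reg_one)" for m t
    using that unfolding loop_inv_def registers_def by auto
qed (use assms in auto)

text \<open>
  The summation loop takes at most \<open>3 n + 1\<close> operations, the initialisation of \<open>\<beta>\<close> one, and
  the search at most \<open>15 (2 n + 1) + 1\<close>. Their sum \<open>33 n + 18\<close> is at most \<open>51 n\<close>
  because \<open>n\<close> is positive.
\<close>

theorem search_program_correct:
  "\<exists>\<alpha> \<beta>. clip_pair \<alpha> \<beta> \<and> computes_within (51 * n) search_program n p \<kappa> lam \<alpha> \<beta>"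
proof -
  let ?Q = "\<lambda>t (_ :: nat). \<exists>\<alpha> \<beta>. clip_pair \<alpha> \<beta> \<and> t reg_alpha = real \<alpha> \<and> t reg_beta = real \<beta>"
  have search: "runs input (seqs [Arith reg_beta Plus reg_alpha reg_one,
      While reg_done Less reg_one search_body]) t M ?Q"
    if "sum_inv m t" "\<not> t reg_tmp < t reg_alpha" "48 * n \<le> M + 1" for m t M
    using that n_pos
    by (intro runs_straight runs_mono[OF runs_search_loop]) (auto simp: sum_inv_def registers_def)
  have sum: "runs input (While reg_tmp Less reg_alpha sum_body) s (51 * n)
      (\<lambda>t M. runs input (seqs [Arith reg_beta Plus reg_alpha reg_one,
        While reg_done Less reg_one search_body]) t M ?Q)"
    if "sum_inv n s" for s
  proof (rule runs_While[where I = sum_inv and m = n and K = 2])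
    show "runs input (seqs [Arith reg_beta Plus reg_alpha reg_one,
        While reg_done Less reg_one search_body]) t M ?Q"
      if "sum_inv m t" "\<not> compare Less (t reg_tmp) (t reg_alpha)"
        "51 * n \<le> M + ((2 + 1) * n + 1)" for m t M
      using that by (intro search) auto
  qed (use that n_pos in \<open>auto intro: runs_sum_body\<close>)
  have "runs input search_program (initial_state n p \<kappa>) (51 * n) ?Q"
    unfolding search_program_def
    by (intro runs_straight sum) (auto simp: sum_inv_def initial_state_def)
  then obtain k t \<alpha> \<beta> where "exec input search_program (initial_state n p \<kappa>) k t" "k \<le> 51 * n"
      "clip_pair \<alpha> \<beta>" "t reg_alpha = real \<alpha>" "t reg_beta = real \<beta>"
    unfolding runs_def by blast
  then show ?thesis unfolding computes_within_def input_def by (intro exI conjI)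
qed

end

section \<open>The constrained covariance approximation\<close>

theorem theorem3p1:
  shows "\<exists>(P :: com) (C :: nat).
    \<forall>(n :: nat) (p :: nat) (\<kappa> :: real) (X :: real mat) (U :: real mat) (lam :: nat \<Rightarrow> real).
      0 < n \<longrightarrow> n < p \<longrightarrow> 1 \<le> \<kappa> \<longrightarrow>
      X \<in> carrier_mat p n \<longrightarrow> vec_space.rank p X = n \<longrightarrow>
      spectral_decomposition p (sample_cov n X) U lam \<longrightarrow>
      (\<forall>i j. 1 \<le> i \<longrightarrow> i \<le> j \<longrightarrow> j \<le> n \<longrightarrow> lam j \<le> lam i) \<longrightarrow>
      lam n > 0 \<longrightarrow>
      (\<forall>i. n + 1 \<le> i \<longrightarrow> i \<le> p \<longrightarrow> lam i = 0) \<longrightarrow>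
      (\<exists>\<alpha> \<beta>. \<alpha> \<in> {1..n} \<and> \<beta> \<in> {2..n + 1} \<and> \<alpha> \<le> \<beta> - 1 \<and>
        solutions p \<kappa> (sample_cov n X) = {U * Lambda_star n p \<kappa> lam \<alpha> \<beta> * U\<^sup>T} \<and>
        computes_within (C * n) P n p \<kappa> lam \<alpha> \<beta>)"
proof (rule exI[of _ search_program], rule exI[of _ 51], intro allI impI)
  fix n p :: nat and \<kappa> :: real and X U :: "real mat" and lam :: "nat \<Rightarrow> real"
  assume "0 < n" "n < p" "1 \<le> \<kappa>"
    and dec: "spectral_decomposition p (sample_cov n X) U lam"
    and "\<forall>i j. 1 \<le> i \<longrightarrow> i \<le> j \<longrightarrow> j \<le> n \<longrightarrow> lam j \<le> lam i"
    and "lam n > 0" "\<forall>i. n + 1 \<le> i \<longrightarrow> i \<le> p \<longrightarrow> lam i = 0"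
  then interpret sorted_eigenvalues n p \<kappa> lam by unfold_locales auto
  obtain \<alpha> \<beta> where cp: "clip_pair \<alpha> \<beta>"
    and prog: "computes_within (51 * n) search_program n p \<kappa> lam \<alpha> \<beta>"
    using search_program_correct by blast
  have "\<alpha> \<in> {1..n} \<and> \<beta> \<in> {2..n + 1} \<and> \<alpha> \<le> \<beta> - 1"
    using cp by (auto simp: clip_pair_def)
  then show "\<exists>\<alpha> \<beta>. \<alpha> \<in> {1..n} \<and> \<beta> \<in> {2..n + 1} \<and> \<alpha> \<le> \<beta> - 1 \<and>
      solutions p \<kappa> (sample_cov n X) = {U * Lambda_star n p \<kappa> lam \<alpha> \<beta> * U\<^sup>T} \<and>
      computes_within (51 * n) search_program n p \<kappa> lam \<alpha> \<beta>"
    using solutions_clip_pair[OF dec cp] prog by blast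
qed

end
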